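(* Let $K \subseteq \square^{n}$ be a finite cubical complex such that $\operatorname{sk}_{2}(K)=K$ (all cells have dimension at most $2$), and let $M$ satisfy $0<M<n$. Let $A=K(0,M)$ and $B=K(M+1,n)$, let $L$ be the frontier subcomplex, and let $u$ be a vertex of $A$ and $v$ a vertex of $B$. Then the diagram of sets $$\bigsqcup_{\omega} P(A)(u,\omega(0,0)) \times P(B)(\omega(1,1),v) \rightrightarrows \bigsqcup_{x \xrightarrow{\sigma} y \,\in\, L} P(A)(u,x) \times P(B)(y,v) \to P(K)(u,v)$$ is a coequalizer. Here the middle coproduct is over all $1$-simplices $\sigma: x\to y$ of $\vert L\vert$ with $x\in A$ and $y\in B$, and the left coproduct is over all simplicial maps $\omega:\Delta^{1}\times\Delta^{1}\to\vert K\vert$ (degenerate $2$-simplices allowed) such that the edge $\omega(0,0)\to\omega(0,1)$ is in $\vert A\vert$ and the edge $\omega(1,0)\to\omega(1,1)$ is in $\vert B\vert$. The right-hand map sends $(p,q)$ in the summand of $\sigma$ to the composite $q\circ\sigma\circ p$ in $P(K)$. For each $\omega$, with $\alpha_{0}:\omega(0,0)\to\omega(1,0)$ and $\alpha_{1}:\omega(0,1)\to\omega(1,1)$ the corresponding edges, the two parallel maps send $(p,q)$ in the summand of $\omega$ respectively to the element $(p,\ q\circ[\omega(1,0)\to\omega(1,1)])$ of the summand of $\alpha_{0}$, and to the element $([\omega(0,0)\to\omega(0,1)]\circ p,\ q)$ of the summand of $\alpha_{1}$.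
   Context: Let $\underline{n}=\{1,2,\dots,n\}$ and let $\mathcal{P}(\underline{n})$ be the poset of its subsets. For $C \subseteq D \subseteq \underline{n}$ write $[C,D]=\{F \mid C\subseteq F\subseteq D\}$. A finite cubical complex $K \subseteq \square^{n}$ is a set of intervals $[C,D]\subseteq \mathcal{P}(\underline{n})$ (its cells; $[C,D]$ has dimension $\vert D\setminus C\vert$) closed under taking subintervals; its vertices are the $F\subseteq\underline{n}$ with $[F,F]\in K$, and the vertices of the cell $[C,D]$ are the elements of $[C,D]$. The triangulation $\vert K\vert$ is the subcomplex of the nerve $B\mathcal{P}(\underline{n})$ which is the union of the nerves of the posets $[C,D]$ over the cells $[C,D]$ of $K$; so a $1$-simplex of $\vert K\vert$ is a pair $F\subseteq F'$ with $[F,F']\in K$ (including diagonals of $2$-cells). The path category functor $X\mapsto P(X)$ from simplicial sets to small categories is the left adjoint of the nerve functor: $P(X)$ has the vertices of $X$ as objects, and is the category freely generated by the $1$-simplices modulo the relations that degenerate $1$-simplices are identities and $d_{1}\sigma = d_{0}\sigma\circ d_{2}\sigma$ for each $2$-simplex $\sigma$. For a cubical complex $K$, $P(K):=P(\vert K\vert)$, and $P(K)(u,v)$ is the set of morphisms from $u$ to $v$. Morphisms of $P(A)$ and $P(B)$ are regarded as morphisms of $P(K)$ via the functors induced by the inclusions $A,B\subseteq K$. For a $1$-simplex $a\to b$ of $\vert A\vert$ or $\vert B\vert$, $[a\to b]$ denotes the morphism of $P(A)$ or $P(B)$ that it represents. For integers $r\le s$, $K(r,s)$ is the subcomplex of $K$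 consisting of the cells all of whose vertices $F$ satisfy $r\le\vert F\vert\le s$. Thus $A=K(0,M)$ has the vertices of $K$ of cardinality at most $M$, and $B=K(M+1,n)$ has those of cardinality at least $M+1$. The frontier subcomplex $L\subseteq K$ is the subcomplex generated by the $1$-cells and $2$-cells of $K$ which have vertices in both $A$ and $B$. *)

theory Defs
  imports Main "HOL-Library.FuncSet"
begin

section \<open>Simplicial sets\<close>

text \<open>
  \<open>face X k i\<close> is the face operator $d_i$ from $X_k$ to $X_{k-1}$ (for $k > 0$, $i \le k$) and
  \<open>degen X k i\<close> is the degeneracy operator $s_i$ from $X_k$ to $X_{k+1}$ (for $i \le k$).
\<close>

record 'a sset =
  simplices :: "nat \<Rightarrow> 'a set"
  face :: "nat \<Rightarrow> nat \<Rightarrow> 'a \<Rightarrow> 'a"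
  degen :: "nat \<Rightarrow> nat \<Rightarrow> 'a \<Rightarrow> 'a"

definition simplicial_set :: "'a sset \<Rightarrow> bool" where
  "simplicial_set X \<longleftrightarrow>
     (\<forall>k i. i \<le> Suc k \<longrightarrow> face X (Suc k) i \<in> simplices X (Suc k) \<rightarrow> simplices X k) \<and>
     (\<forall>k i. i \<le> k \<longrightarrow> degen X k i \<in> simplices X k \<rightarrow> simplices X (Suc k)) \<and>
     (\<forall>k i j. \<forall>x \<in> simplices X (Suc (Suc k)). i < j \<and> j \<le> Suc (Suc k) \<longrightarrow>
        face X (Suc k) i (face X (Suc (Suc k)) j x)
          = face X (Suc k) (j - 1) (face X (Suc (Suc k)) i x)) \<and>
     (\<forall>k i j. \<forall>x \<in> simplices X k. i \<le> j \<and> j \<le> k \<longrightarrow>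
        degen X (Suc k) i (degen X k j x) = degen X (Suc k) (Suc j) (degen X k i x)) \<and>
     (\<forall>k i j. \<forall>x \<in> simplices X (Suc k). i < j \<and> j \<le> Suc k \<longrightarrow>
        face X (Suc (Suc k)) i (degen X (Suc k) j x)
          = degen X k (j - 1) (face X (Suc k) i x)) \<and>
     (\<forall>k i j. \<forall>x \<in> simplices X k. j \<le> k \<and> (i = j \<or> i = Suc j) \<longrightarrow>
        face X (Suc k) i (degen X k j x) = x) \<and>
     (\<forall>k i j. \<forall>x \<in> simplices X (Suc k). Suc j < i \<and> i \<le> Suc (Suc k) \<longrightarrow>
        face X (Suc (Suc k)) i (degen X (Suc k) j x)
          = degen X k j (face X (Suc k) (i - 1) x))"

text \<open>Maps are taken extensional, so that distinct members are distinct simplicial maps.\<close>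

definition simplicial_map :: "'a sset \<Rightarrow> 'b sset \<Rightarrow> (nat \<Rightarrow> 'a \<Rightarrow> 'b) \<Rightarrow> bool" where
  "simplicial_map X Y f \<longleftrightarrow>
     (\<forall>k. f k \<in> simplices X k \<rightarrow>\<^sub>E simplices Y k) \<and>
     (\<forall>k i. \<forall>x \<in> simplices X (Suc k). i \<le> Suc k \<longrightarrow>
        f k (face X (Suc k) i x) = face Y (Suc k) i (f (Suc k) x)) \<and>
     (\<forall>k i. \<forall>x \<in> simplices X k. i \<le> k \<longrightarrow>
        f (Suc k) (degen X k i x) = degen Y k i (f k x))"

text \<open>A \<open>k\<close>-simplex of the nerve of a poset is a weakly increasing list of length \<open>k + 1\<close>.\<close>

definition nerve :: "'a::order set \<Rightarrow> 'a list sset" where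
  "nerve P = \<lparr>
     simplices = (\<lambda>k. {xs. length xs = Suc k \<and> sorted_wrt (\<le>) xs \<and> set xs \<subseteq> P}),
     face = (\<lambda>k i xs. take i xs @ drop (Suc i) xs),
     degen = (\<lambda>k i xs. take (Suc i) xs @ drop i xs)\<rparr>"

definition std_simplex :: "nat \<Rightarrow> nat list sset" where
  "std_simplex m = nerve {0..m}"

definition sset_prod :: "'a sset \<Rightarrow> 'b sset \<Rightarrow> ('a \<times> 'b) sset" where
  "sset_prod X Y = \<lparr>
     simplices = (\<lambda>k. simplices X k \<times> simplices Y k),
     face = (\<lambda>k i. map_prod (face X k i) (face Y k i)),
     degen = (\<lambda>k i. map_prod (degen X k i) (degen Y k i))\<rparr>"


section \<open>The path category\<close>

definition src :: "'a sset \<Rightarrow> 'a \<Rightarrow> 'a" where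
  "src X e = face X 1 1 e"

definition tgt :: "'a sset \<Rightarrow> 'a \<Rightarrow> 'a" where
  "tgt X e = face X 1 0 e"

text \<open>
  A triple \<open>(x, es, y)\<close> is a composable string of \<open>1\<close>-simplices from \<open>x\<close> to \<open>y\<close>, listed in the
  order in which they are traversed; these are the morphisms of the free category on the
  \<open>1\<close>-simplices.
\<close>

inductive_set paths :: "'a sset \<Rightarrow> ('a \<times> 'a list \<times> 'a) set" for X where
  empty: "x \<in> simplices X 0 \<Longrightarrow> (x, [], x) \<in> paths X"
| cons: "e \<in> simplices X 1 \<Longrightarrow> (tgt X e, es, y) \<in> paths X \<Longrightarrow> (src X e, e # es, y) \<in> paths X"

inductive_set path_rel :: "'a sset \<Rightarrow> (('a \<times> 'a list \<times> 'a) \<times> ('a \<times> 'a list \<times> 'a)) set" for X where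
  refl: "w \<in> paths X \<Longrightarrow> (w, w) \<in> path_rel X"
| sym: "(w, w') \<in> path_rel X \<Longrightarrow> (w', w) \<in> path_rel X"
| trans: "(w, w') \<in> path_rel X \<Longrightarrow> (w', w'') \<in> path_rel X \<Longrightarrow> (w, w'') \<in> path_rel X"
| degenerate: "z \<in> simplices X 0 \<Longrightarrow> (x, es, z) \<in> paths X \<Longrightarrow> (z, fs, y) \<in> paths X \<Longrightarrow>
    ((x, es @ [degen X 0 0 z] @ fs, y), (x, es @ fs, y)) \<in> path_rel X"
| triangle: "\<tau> \<in> simplices X 2 \<Longrightarrow> (x, es, src X (face X 2 1 \<tau>)) \<in> paths X \<Longrightarrow>
    (tgt X (face X 2 1 \<tau>), fs, y) \<in> paths X \<Longrightarrow>
    ((x, es @ [face X 2 1 \<tau>] @ fs, y), (x, es @ [face X 2 2 \<tau>, face X 2 0 \<tau>] @ fs, y))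
      \<in> path_rel X"

definition path_class :: "'a sset \<Rightarrow> ('a \<times> 'a list \<times> 'a) \<Rightarrow> ('a \<times> 'a list \<times> 'a) set" where
  "path_class X w = path_rel X `` {w}"

definition path_hom :: "'a sset \<Rightarrow> 'a \<Rightarrow> 'a \<Rightarrow> ('a \<times> 'a list \<times> 'a) set set" where
  "path_hom X x y = {w \<in> paths X. \<exists>es. w = (x, es, y)} // path_rel X"

text \<open>\<open>path_comp X q p\<close> is the composite $q \circ p$ in the path category (first \<open>p\<close>, then \<open>q\<close>).\<close>

definition path_comp ::
    "'a sset \<Rightarrow> ('a \<times> 'a list \<times> 'a) set \<Rightarrow> ('a \<times> 'a list \<times> 'a) set \<Rightarrow> ('a \<times> 'a list \<times> 'a) set" where
  "path_comp X q p =
     \<Union> {path_class X (x, es @ fs, z) | x es y fs z. (x, es, y) \<in> p \<and> (y, fs, z) \<in> q}"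

definition path_edge :: "'a sset \<Rightarrow> 'a \<Rightarrow> ('a \<times> 'a list \<times> 'a) set" where
  "path_edge X e = path_class X (src X e, [e], tgt X e)"

text \<open>The functor into the path category of \<open>Y\<close> induced by the inclusion of a simplicial subset.\<close>

definition path_incl :: "'a sset \<Rightarrow> ('a \<times> 'a list \<times> 'a) set \<Rightarrow> ('a \<times> 'a list \<times> 'a) set" where
  "path_incl Y p = (\<Union>w\<in>p. path_class Y w)"


section \<open>Cubical complexes\<close>

text \<open>
  A cell is the interval \<open>{C..D}\<close> itself, i.e. the set of all \<open>F\<close> with \<open>C \<subseteq> F \<subseteq> D\<close>.
  For \<open>C \<subseteq> D\<close> it determines \<open>C\<close> and \<open>D\<close>.
\<close>

definition cubical_complex :: "nat \<Rightarrow> nat set set set \<Rightarrow> bool" where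
  "cubical_complex n K \<longleftrightarrow>
     (\<forall>c\<in>K. \<exists>C D. C \<subseteq> D \<and> D \<subseteq> {1..n} \<and> c = {C..D}) \<and>
     (\<forall>C D C' D'. {C..D} \<in> K \<and> C \<subseteq> C' \<and> C' \<subseteq> D' \<and> D' \<subseteq> D \<longrightarrow> {C'..D'} \<in> K)"

definition vertices :: "nat set set set \<Rightarrow> nat set set" where
  "vertices K = {F. {F..F} \<in> K}"

definition skeleton :: "nat \<Rightarrow> nat set set set \<Rightarrow> nat set set set" where
  "skeleton d K = {{C..D} | C D. C \<subseteq> D \<and> {C..D} \<in> K \<and> card (D - C) \<le> d}"

definition level :: "nat set set set \<Rightarrow> nat \<Rightarrow> nat \<Rightarrow> nat set set set" where
  "level K r s = {c \<in> K. \<forall>F\<in>c. r \<le> card F \<and> card F \<le> s}"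

definition generated_subcomplex ::
    "nat \<Rightarrow> nat set set set \<Rightarrow> nat set set set \<Rightarrow> nat set set set" where
  "generated_subcomplex n K G = \<Inter> {H. cubical_complex n H \<and> H \<subseteq> K \<and> G \<subseteq> H}"

definition frontier_subcomplex :: "nat \<Rightarrow> nat set set set \<Rightarrow> nat \<Rightarrow> nat set set set" where
  "frontier_subcomplex n K M = generated_subcomplex n K
     {{C..D} | C D. C \<subseteq> D \<and> {C..D} \<in> K \<and> card (D - C) \<in> {1, 2} \<and>
        {C..D} \<inter> vertices (level K 0 M) \<noteq> {} \<and>
        {C..D} \<inter> vertices (level K (M + 1) n) \<noteq> {}}"

definition triangulation :: "nat set set set \<Rightarrow> nat set list sset" where
  "triangulation K = (nerve UNIV)\<lparr>simplices := \<lambda>k. \<Union>c\<in>K. simplices (nerve c) k\<rparr>"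


section \<open>The coequalizer diagram\<close>

text \<open>
  Universal property of a coequalizer in sets, tested against all target sets \<open>Z\<close> of elements of
  type \<open>'z\<close>. HOL cannot quantify over types inside a formula; a theorem stated with \<open>'z\<close> as a
  type variable covers all targets.
\<close>

definition is_coequalizer ::
    "'z itself \<Rightarrow> 'r set \<Rightarrow> 'e set \<Rightarrow> 'c set \<Rightarrow> ('r \<Rightarrow> 'e) \<Rightarrow> ('r \<Rightarrow> 'e) \<Rightarrow> ('e \<Rightarrow> 'c) \<Rightarrow> bool" where
  "is_coequalizer _ R E C f g e \<longleftrightarrow>
     f \<in> R \<rightarrow> E \<and> g \<in> R \<rightarrow> E \<and> e \<in> E \<rightarrow> C \<and> (\<forall>r\<in>R. e (f r) = e (g r)) \<and>
     (\<forall>(Z :: 'z set) h. h \<in> E \<rightarrow> Z \<and> (\<forall>r\<in>R. h (f r) = h (g r)) \<longrightarrow>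
        (\<exists>!k. k \<in> C \<rightarrow>\<^sub>E Z \<and> (\<forall>x\<in>E. k (e x) = h x)))"

text \<open>
  For \<open>\<omega>\<close> defined on the product of two standard \<open>1\<close>-simplices: its value at the vertex \<open>(i, j)\<close>,
  and at the edge from \<open>(i, j)\<close> to \<open>(i', j')\<close>.
\<close>

definition sq_vertex :: "(nat \<Rightarrow> nat list \<times> nat list \<Rightarrow> 'a) \<Rightarrow> nat \<times> nat \<Rightarrow> 'a" where
  "sq_vertex \<omega> = (\<lambda>(i, j). \<omega> 0 ([i], [j]))"

definition sq_edge :: "(nat \<Rightarrow> nat list \<times> nat list \<Rightarrow> 'a) \<Rightarrow> nat \<times> nat \<Rightarrow> nat \<times> nat \<Rightarrow> 'a" where
  "sq_edge \<omega> = (\<lambda>(i, j) (i', j'). \<omega> 1 ([i, i'], [j, j']))"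

definition squares ::
    "'a sset \<Rightarrow> 'a sset \<Rightarrow> 'a sset \<Rightarrow> (nat \<Rightarrow> nat list \<times> nat list \<Rightarrow> 'a) set" where
  "squares X XA XB = {\<omega>. simplicial_map (sset_prod (std_simplex 1) (std_simplex 1)) X \<omega> \<and>
     sq_edge \<omega> (0, 0) (0, 1) \<in> simplices XA 1 \<and>
     sq_edge \<omega> (1, 0) (1, 1) \<in> simplices XB 1}"

definition crossing_edges :: "'a sset \<Rightarrow> 'a sset \<Rightarrow> 'a sset \<Rightarrow> 'a set" where
  "crossing_edges XL XA XB =
     {\<sigma> \<in> simplices XL 1. src XL \<sigma> \<in> simplices XA 0 \<and> tgt XL \<sigma> \<in> simplices XB 0}"

end

theory Submission
  imports Defs
begin

text \<open>
  Cardinality does not decrease along an edge, so a path of \<open>K\<close> from \<open>u\<close> to \<open>v\<close> consists of a path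
  in \<open>A\<close>, one crossing edge, and a path in \<open>B\<close>; the crossing edge lies in \<open>L\<close> because the cells have
  dimension at most \<open>2\<close>. Hence every morphism of the path category comes from the middle coproduct,
  and it remains to see that the element of the coequalizer determined by this splitting is
  invariant under the relations of the path category. A degeneracy, or a triangle inside \<open>A\<close> or
  \<open>B\<close>, only changes one of the two outer paths within its class. A triangle \<open>F \<rightarrow> G \<rightarrow> H\<close> with \<open>F\<close>
  in \<open>A\<close> and \<open>H\<close> in \<open>B\<close> is a square with one degenerate side: the edge at \<open>H\<close> if \<open>G\<close> is in \<open>A\<close>,
  and the edge at \<open>F\<close> if \<open>G\<close> is in \<open>B\<close>.
\<close>

text \<open>Keeps the dimension \<open>1\<close> in the form in which it occurs in
  \<open>src\<close>, \<open>tgt\<close> and \<open>paths\<close>.\<close>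

declare One_nat_def [simp del]

section \<open>Path categories\<close>

text \<open>Only the simplices of dimension at most \<open>2\<close> enter the path category.\<close>

locale truncated_sset =
  fixes X :: "'a sset"
  assumes src_vertex: "e \<in> simplices X 1 \<Longrightarrow> src X e \<in> simplices X 0"
    and tgt_vertex: "e \<in> simplices X 1 \<Longrightarrow> tgt X e \<in> simplices X 0"
    and degen_edge: "z \<in> simplices X 0 \<Longrightarrow> degen X 0 0 z \<in> simplices X 1"
    and src_degen: "z \<in> simplices X 0 \<Longrightarrow> src X (degen X 0 0 z) = z"
    and tgt_degen: "z \<in> simplices X 0 \<Longrightarrow> tgt X (degen X 0 0 z) = z"
    and face_edge: "\<tau> \<in> simplices X 2 \<Longrightarrow> i \<le> 2 \<Longrightarrow> face X 2 i \<tau> \<in> simplices X 1"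
    and src_face_1: "\<tau> \<in> simplices X 2 \<Longrightarrow> src X (face X 2 1 \<tau>) = src X (face X 2 2 \<tau>)"
    and tgt_face_1: "\<tau> \<in> simplices X 2 \<Longrightarrow> tgt X (face X 2 1 \<tau>) = tgt X (face X 2 0 \<tau>)"
    and tgt_face_2: "\<tau> \<in> simplices X 2 \<Longrightarrow> tgt X (face X 2 2 \<tau>) = src X (face X 2 0 \<tau>)"
begin

section \<open>Paths and the congruence generated by the relations\<close>

lemma paths_Nil_iff: "(x, [], y) \<in> paths X \<longleftrightarrow> x = y \<and> x \<in> simplices X 0"
  by (auto intro: paths.empty elim: paths.cases)

lemma paths_Cons_iff:
  "(x, e # es, y) \<in> paths X \<longleftrightarrow> e \<in> simplices X 1 \<and> x = src X e \<and> (tgt X e, es, y) \<in> paths X"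
  by (auto intro: paths.cons elim: paths.cases)

lemma paths_endpoints: "(x, es, y) \<in> paths X \<Longrightarrow> x \<in> simplices X 0 \<and> y \<in> simplices X 0"
  by (induction es arbitrary: x) (auto simp: paths_Nil_iff paths_Cons_iff src_vertex)

lemma paths_append_iff:
  "(x, es @ fs, z) \<in> paths X \<longleftrightarrow> (\<exists>y. (x, es, y) \<in> paths X \<and> (y, fs, z) \<in> paths X)"
  by (induction es arbitrary: x) (auto simp: paths_Nil_iff paths_Cons_iff dest: paths_endpoints)

lemma paths_append:
  "(x, es, y) \<in> paths X \<Longrightarrow> (y, fs, z) \<in> paths X \<Longrightarrow> (x, es @ fs, z) \<in> paths X"
  by (auto simp: paths_append_iff)

lemma paths_edge: "e \<in> simplices X 1 \<Longrightarrow> (src X e, [e], tgt X e) \<in> paths X"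
  by (simp add: paths_Cons_iff paths_Nil_iff tgt_vertex)

text \<open>A degenerate edge is a loop at its vertex, and the simplicial identities match the ends
  of the three faces of a triangle. So the generators relate parallel paths, and a class determines
  its endpoints.\<close>

lemma path_rel_paths:
  "(w, w') \<in> path_rel X \<Longrightarrow>
    w \<in> paths X \<and> w' \<in> paths X \<and> fst w = fst w' \<and> snd (snd w) = snd (snd w')"
proof (induction rule: path_rel.induct)
  case (degenerate z x es fs y)
  then show ?case
    by (auto simp: paths_append_iff paths_Cons_iff degen_edge src_degen tgt_degen)
next
  case (triangle \<tau> x es fs y)
  have "(src X (face X 2 1 \<tau>), [face X 2 1 \<tau>], tgt X (face X 2 1 \<tau>)) \<in> paths X"
    "(src X (face X 2 1 \<tau>), [face X 2 2 \<tau>, face X 2 0 \<tau>], tgt X (face X 2 1 \<tau>)) \<in> paths X"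
    using triangle(1)
    by (simp_all add: paths_Cons_iff paths_Nil_iff tgt_vertex face_edge src_face_1 tgt_face_1 tgt_face_2)
  from this[THEN paths_append, OF triangle(3)] show ?case
    using paths_append[OF triangle(2)] by simp
qed auto

lemma equiv_path_rel: "equiv (paths X) (path_rel X)"
proof (rule equivI)
  show "path_rel X \<subseteq> paths X \<times> paths X"
    using path_rel_paths by auto
  show "refl_on (paths X) (path_rel X)"
    by (auto simp: refl_on_def intro: path_rel.refl)
  show "sym (path_rel X)" "trans (path_rel X)"
    by (meson symI path_rel.sym) (meson transI path_rel.trans)
qed

text \<open>The generators already carry arbitrary contexts on both sides, so a longer context is
  again an instance of the same generator. This makes \<open>path_rel\<close> compatible with
  concatenation.\<close>

lemma path_rel_append:
  assumes "(w, w') \<in> path_rel X" "(x, es, fst w) \<in> paths X" "(snd (snd w), fs, z) \<in> paths X"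
  shows "((x, es @ fst (snd w) @ fs, z), (x, es @ fst (snd w') @ fs, z)) \<in> path_rel X"
  using assms
proof (induction rule: path_rel.induct)
  case (refl w)
  then show ?case
    by (cases w) (auto intro!: path_rel.refl paths_append)
next
  case (sym w w')
  then show ?case
    using path_rel_paths[OF sym.hyps] by (auto intro: path_rel.sym)
next
  case (trans w w' w'')
  then show ?case
    using path_rel_paths[OF trans.hyps(1)] by (auto intro: path_rel.trans)
next
  case (degenerate c a l r b)
  then show ?case
    using path_rel.degenerate[of c X x "es @ l" "r @ fs" z] by (auto intro: paths_append)
next
  case (triangle \<tau> a l r b)
  then show ?case
    using path_rel.triangle[of \<tau> X x "es @ l" "r @ fs" z] by (auto intro: paths_append)
qed

section \<open>Morphisms and their composition\<close>

lemma path_class_eqI: "(w, w') \<in> path_rel X \<Longrightarrow> path_class X w = path_class X w'"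
  unfolding path_class_def by (rule equiv_class_eq[OF equiv_path_rel])

lemma mem_path_class: "w' \<in> path_class X w \<longleftrightarrow> (w, w') \<in> path_rel X"
  by (simp add: path_class_def)

lemma path_hom_iff:
  "c \<in> path_hom X x y \<longleftrightarrow> (\<exists>es. (x, es, y) \<in> paths X \<and> c = path_class X (x, es, y))"
  by (auto simp: path_hom_def quotient_def path_class_def)

text \<open>One factor is replaced at a time, the other serving as context in
  \<open>path_rel_append\<close>.\<close>

lemma path_class_append_cong:
  assumes "((x, es, y), (x, es', y)) \<in> path_rel X" "((y, fs, z), (y, fs', z)) \<in> path_rel X"
  shows "path_class X (x, es @ fs, z) = path_class X (x, es' @ fs', z)"
proof -
  have "(x, [], x) \<in> paths X" "(z, [], z) \<in> paths X" "(x, es', y) \<in> paths X" "(y, fs, z) \<in> paths X"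
    using path_rel_paths[OF assms(1)] path_rel_paths[OF assms(2)]
    by (auto simp: paths_Nil_iff dest: paths_endpoints)
  then have "((x, es @ fs, z), (x, es' @ fs, z)) \<in> path_rel X"
    "((x, es' @ fs, z), (x, es' @ fs', z)) \<in> path_rel X"
    using path_rel_append[OF assms(1), of x "[]" fs z]
      path_rel_append[OF assms(2), of x es' "[]" z] by auto
  then show ?thesis
    by (metis path_class_eqI)
qed

text \<open>\<open>path_comp\<close> is a union over all pairs of composable representatives. By the
  congruence property all the sets in this union coincide, and the given pair shows that there is at
  least one.\<close>

lemma path_comp_class:
  assumes "(x, es, y) \<in> paths X" "(y, fs, z) \<in> paths X"
  shows "path_comp X (path_class X (y, fs, z)) (path_class X (x, es, y)) = path_class X (x, es @ fs, z)"
proof -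
  have "path_class X (x', es' @ fs', z') = path_class X (x, es @ fs, z)"
    if "((x, es, y), (x', es', y')) \<in> path_rel X" "((y, fs, z), (y', fs', z')) \<in> path_rel X"
    for x' es' y' fs' z'
    using path_rel_paths[OF that(1)] path_rel_paths[OF that(2)]
      path_class_append_cong[of x es y es' fs z fs'] that
    by auto
  moreover have "((x, es, y), (x, es, y)) \<in> path_rel X" "((y, fs, z), (y, fs, z)) \<in> path_rel X"
    using assms by (auto intro: path_rel.refl)
  ultimately show ?thesis
    unfolding path_comp_def mem_path_class by blast
qed

lemma path_comp_edge:
  assumes "e \<in> simplices X 1"
  shows "(x, es, src X e) \<in> paths X \<Longrightarrow>
      path_comp X (path_edge X e) (path_class X (x, es, src X e)) = path_class X (x, es @ [e], tgt X e)"
    and "(tgt X e, es, y) \<in> paths X \<Longrightarrow>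
      path_comp X (path_class X (tgt X e, es, y)) (path_edge X e) = path_class X (src X e, e # es, y)"
  using path_comp_class paths_edge[OF assms] by (auto simp: path_edge_def)

lemma path_class_degenerate:
  assumes "(x, es, z) \<in> paths X" "(z, fs, y) \<in> paths X"
  shows "path_class X (x, es @ degen X 0 0 z # fs, y) = path_class X (x, es @ fs, y)"
  using path_class_eqI[OF path_rel.degenerate[OF _ assms]] paths_endpoints[OF assms(1)] by simp

lemma path_class_triangle:
  assumes "\<tau> \<in> simplices X 2" "(x, es, src X (face X 2 1 \<tau>)) \<in> paths X"
    "(tgt X (face X 2 1 \<tau>), fs, y) \<in> paths X"
  shows "path_class X (x, es @ face X 2 2 \<tau> # face X 2 0 \<tau> # fs, y)
    = path_class X (x, es @ face X 2 1 \<tau> # fs, y)"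
  using path_class_eqI[OF path_rel.triangle[OF assms]] by simp

end

text \<open>Face and degeneracy operators are required to be equal as functions, so paths of
  \<open>A\<close> are literally paths of \<open>X\<close> and the inclusion functor needs no
  translation of representatives.\<close>

locale truncated_subset = sub: truncated_sset A + truncated_sset X for A X :: "'a sset" +
  assumes simplices_mono: "simplices A k \<subseteq> simplices X k"
    and face_eq: "face A = face X"
    and degen_eq: "degen A = degen X"
begin

section \<open>The functor induced by an inclusion\<close>

lemma src_eq: "src A = src X" and tgt_eq: "tgt A = tgt X"
  by (auto simp: src_def tgt_def face_eq fun_eq_iff)

lemma simplex_mono: "e \<in> simplices A k \<Longrightarrow> e \<in> simplices X k"
  using simplices_mono by blast

lemma paths_mono: "w \<in> paths A \<Longrightarrow> w \<in> paths X"
proof (cases w)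
  case (fields x es y)
  have "(x, es, y) \<in> paths A \<Longrightarrow> (x, es, y) \<in> paths X"
    by (induction es arbitrary: x)
      (auto simp: sub.paths_Nil_iff paths_Nil_iff sub.paths_Cons_iff paths_Cons_iff
        simplex_mono src_eq tgt_eq)
  then show "w \<in> paths A \<Longrightarrow> w \<in> paths X"
    using fields by simp
qed

lemma path_rel_mono: "(w, w') \<in> path_rel A \<Longrightarrow> (w, w') \<in> path_rel X"
proof (induction rule: path_rel.induct)
  case (refl w)
  then show ?case
    by (cases w) (simp add: path_rel.refl paths_mono)
next
  case (sym w w')
  then show ?case
    by (blast intro: path_rel.sym)
next
  case (trans w w' w'')
  show ?case
    by (rule path_rel.trans[OF trans.IH])
next
  case (degenerate z x es fs y)
  then show ?case
    using path_rel.degenerate[of z X x es fs y] by (simp add: simplex_mono paths_mono degen_eq)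
next
  case (triangle \<tau> x es fs y)
  then show ?case
    using path_rel.triangle[of \<tau> X x es fs y]
    by (simp add: simplex_mono paths_mono face_eq src_eq tgt_eq)
qed

text \<open>Related paths of \<open>A\<close> are related in \<open>X\<close>, so the union defining
  \<open>path_incl\<close> runs over copies of a single class.\<close>

lemma path_incl_class:
  assumes "w \<in> paths A"
  shows "path_incl X (path_class A w) = path_class X w"
proof -
  have "path_class X w' = path_class X w" if "w' \<in> path_class A w" for w'
    using that by (metis path_rel_mono path_class_eqI sub.mem_path_class)
  moreover have "w \<in> path_class A w"
    using assms by (simp add: sub.mem_path_class path_rel.refl)
  ultimately show ?thesis
    unfolding path_incl_def by (intro SUP_eq_const) blast+
qed

end


section \<open>Squares\<close>

locale square = truncated_sset X for X :: "'a sset" +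
  fixes \<omega> :: "nat \<Rightarrow> nat list \<times> nat list \<Rightarrow> 'a"
  assumes map: "simplicial_map (sset_prod (std_simplex 1) (std_simplex 1)) X \<omega>"
begin

lemma simplex: "x \<in> simplices (sset_prod (std_simplex 1) (std_simplex 1)) k \<Longrightarrow> \<omega> k x \<in> simplices X k"
  using map by (auto simp: simplicial_map_def)

lemma face_map:
  "x \<in> simplices (sset_prod (std_simplex 1) (std_simplex 1)) (Suc k) \<Longrightarrow> i \<le> Suc k \<Longrightarrow>
    \<omega> k (face (sset_prod (std_simplex 1) (std_simplex 1)) (Suc k) i x) = face X (Suc k) i (\<omega> (Suc k) x)"
  using map by (auto simp: simplicial_map_def)

lemma edge:
  assumes "i \<le> i'" "i' \<le> 1" "j \<le> j'" "j' \<le> 1"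
  shows "sq_edge \<omega> (i, j) (i', j') \<in> simplices X 1"
    and "src X (sq_edge \<omega> (i, j) (i', j')) = sq_vertex \<omega> (i, j)"
    and "tgt X (sq_edge \<omega> (i, j) (i', j')) = sq_vertex \<omega> (i', j')"
  using assms simplex[of "([i, i'], [j, j'])" 1] face_map[of "([i, i'], [j, j'])" 0 0]
    face_map[of "([i, i'], [j, j'])" 0 1]
  by (auto simp: One_nat_def sq_edge_def sq_vertex_def src_def tgt_def sset_prod_def std_simplex_def nerve_def)

text \<open>A weakly increasing chain of three vertices of the square is a 2-simplex of the product,
  possibly degenerate; \<tau> is its image under \<omega>.\<close>

lemma triangle:
  assumes "i \<le> i'" "i' \<le> i''" "i'' \<le> 1" "j \<le> j'" "j' \<le> j''" "j'' \<le> 1"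
  obtains \<tau> where "\<tau> \<in> simplices X 2"
    "face X 2 2 \<tau> = sq_edge \<omega> (i, j) (i', j')"
    "face X 2 1 \<tau> = sq_edge \<omega> (i, j) (i'', j'')"
    "face X 2 0 \<tau> = sq_edge \<omega> (i', j') (i'', j'')"
proof
  let ?x = "([i, i', i''], [j, j', j''])"
  have x: "?x \<in> simplices (sset_prod (std_simplex 1) (std_simplex 1)) (Suc 1)"
    using assms by (auto simp: sset_prod_def std_simplex_def nerve_def)
  show "\<omega> 2 ?x \<in> simplices X 2"
    using simplex[OF x] by (simp add: Suc_1)
  show "face X 2 2 (\<omega> 2 ?x) = sq_edge \<omega> (i, j) (i', j')"
    "face X 2 1 (\<omega> 2 ?x) = sq_edge \<omega> (i, j) (i'', j'')"
    "face X 2 0 (\<omega> 2 ?x) = sq_edge \<omega> (i', j') (i'', j'')"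
    using face_map[OF x, of 2] face_map[OF x, of 1] face_map[OF x, of 0]
    by (simp_all add: One_nat_def sq_edge_def sset_prod_def std_simplex_def nerve_def numeral_2_eq_2)
qed

text \<open>Both ways around the square equal its diagonal, each by one triangle. This is what makes
  the right-hand map of the diagram coequalize the two parallel maps.\<close>

lemma path_class_square:
  assumes "(x, es, sq_vertex \<omega> (0, 0)) \<in> paths X" "(sq_vertex \<omega> (1, 1), fs, y) \<in> paths X"
  shows "path_class X (x, es @ sq_edge \<omega> (0, 0) (1, 0) # sq_edge \<omega> (1, 0) (1, 1) # fs, y)
    = path_class X (x, es @ sq_edge \<omega> (0, 0) (0, 1) # sq_edge \<omega> (0, 1) (1, 1) # fs, y)"
proof -
  have "path_class X (x, es @ sq_edge \<omega> (0, 0) (i, j) # sq_edge \<omega> (i, j) (1, 1) # fs, y)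
      = path_class X (x, es @ sq_edge \<omega> (0, 0) (1, 1) # fs, y)" if ij: "i \<le> 1" "j \<le> 1" for i j
  proof -
    obtain \<tau> where "\<tau> \<in> simplices X 2" "face X 2 2 \<tau> = sq_edge \<omega> (0, 0) (i, j)"
      "face X 2 1 \<tau> = sq_edge \<omega> (0, 0) (1, 1)" "face X 2 0 \<tau> = sq_edge \<omega> (i, j) (1, 1)"
      using triangle[of 0 i 1 0 j 1] ij by auto
    then show ?thesis
      using path_class_triangle[of \<tau> x es fs y] assms edge[of 0 1 0 1] by simp
  qed
  from this[of 1 0] this[of 0 1] show ?thesis
    by simp
qed

end


section \<open>Cutting a simplicial set along its crossing edges\<close>

text \<open>Abstracts the cut by cardinality: \<open>A\<close> is closed under predecessors and
  \<open>B\<close> under successors. The squares with a degenerate side are assumed to exist because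
  a simplicial map needs values in all dimensions, whereas \<open>truncated_sset\<close> controls
  only the lowest ones.\<close>

locale cut_sset = truncated_sset X + A: truncated_subset A X + B: truncated_subset B X
  for X A B :: "'a sset" +
  assumes vertex_cases: "z \<in> simplices X 0 \<Longrightarrow> z \<in> simplices A 0 \<or> z \<in> simplices B 0"
    and disjoint: "z \<in> simplices A 0 \<Longrightarrow> z \<notin> simplices B 0"
    and edge_A: "e \<in> simplices X 1 \<Longrightarrow> tgt X e \<in> simplices A 0 \<Longrightarrow> e \<in> simplices A 1"
    and edge_B: "e \<in> simplices X 1 \<Longrightarrow> src X e \<in> simplices B 0 \<Longrightarrow> e \<in> simplices B 1"
    and triangle_A:
      "\<tau> \<in> simplices X 2 \<Longrightarrow> tgt X (face X 2 1 \<tau>) \<in> simplices A 0 \<Longrightarrow> \<tau> \<in> simplices A 2"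
    and triangle_B:
      "\<tau> \<in> simplices X 2 \<Longrightarrow> src X (face X 2 1 \<tau>) \<in> simplices B 0 \<Longrightarrow> \<tau> \<in> simplices B 2"
    and square_A:
      "\<tau> \<in> simplices X 2 \<Longrightarrow> face X 2 2 \<tau> \<in> simplices A 1 \<Longrightarrow> tgt X (face X 2 1 \<tau>) \<in> simplices B 0 \<Longrightarrow>
        \<exists>\<omega>\<in>squares X A B. sq_edge \<omega> (0, 0) (0, 1) = face X 2 2 \<tau> \<and>
          sq_edge \<omega> (0, 1) (1, 1) = face X 2 0 \<tau> \<and> sq_edge \<omega> (0, 0) (1, 0) = face X 2 1 \<tau> \<and>
          sq_edge \<omega> (1, 0) (1, 1) = degen X 0 0 (tgt X (face X 2 1 \<tau>))"
    and square_B: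
      "\<tau> \<in> simplices X 2 \<Longrightarrow> src X (face X 2 1 \<tau>) \<in> simplices A 0 \<Longrightarrow> face X 2 0 \<tau> \<in> simplices B 1 \<Longrightarrow>
        \<exists>\<omega>\<in>squares X A B. sq_edge \<omega> (0, 0) (0, 1) = degen X 0 0 (src X (face X 2 1 \<tau>)) \<and>
          sq_edge \<omega> (0, 1) (1, 1) = face X 2 1 \<tau> \<and> sq_edge \<omega> (0, 0) (1, 0) = face X 2 2 \<tau> \<and>
          sq_edge \<omega> (1, 0) (1, 1) = face X 2 0 \<tau>"
begin

section \<open>Paths from \<open>A\<close> to \<open>B\<close> and their crossing edges\<close>

definition crossing :: "'a set" where
  "crossing = {\<sigma> \<in> simplices X 1. src X \<sigma> \<in> simplices A 0 \<and> tgt X \<sigma> \<in> simplices B 0}"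

text \<open>
  \<open>split\<close> is meaningful only on paths from \<open>A\<close> to \<open>B\<close>: on a path that stays in \<open>A\<close> it takes the
  head of an empty list.
\<close>

definition split :: "'a \<times> 'a list \<times> 'a \<Rightarrow> 'a \<times> ('a \<times> 'a list \<times> 'a) set \<times> ('a \<times> 'a list \<times> 'a) set" where
  "split = (\<lambda>(x, es, y).
     let pre = takeWhile (\<lambda>e. e \<in> simplices A 1) es; post = dropWhile (\<lambda>e. e \<in> simplices A 1) es
     in (hd post, path_class A (x, pre, src X (hd post)), path_class B (tgt X (hd post), tl post, y)))"

lemma paths_A_edges: "(x, es, y) \<in> paths A \<Longrightarrow> set es \<subseteq> simplices A 1"
  by (induction es arbitrary: x) (auto simp: A.sub.paths_Cons_iff)

text \<open>Every edge of \<open>es\<close> lies in \<open>A\<close>, while \<sigma> does not, since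
  its target is in \<open>B\<close>. Hence \<open>takeWhile\<close> stops exactly at
  \<sigma>.\<close>

lemma split_append:
  assumes "(x, es, z) \<in> paths A" "\<sigma> \<in> crossing"
  shows "split (x, es @ \<sigma> # fs, y) = (\<sigma>, path_class A (x, es, src X \<sigma>), path_class B (tgt X \<sigma>, fs, y))"
proof -
  have "\<sigma> \<notin> simplices A 1"
    using assms(2) A.sub.tgt_vertex disjoint by (auto simp: crossing_def A.tgt_eq)
  moreover have "e \<in> simplices A 1" if "e \<in> set es" for e
    using paths_A_edges[OF assms(1)] that by auto
  ultimately show ?thesis
    by (simp add: split_def takeWhile_append2 dropWhile_append2)
qed

text \<open>Membership in \<open>A\<close> propagates backwards: once the tail is a path of
  \<open>A\<close>, the target of the first edge is in \<open>A\<close>, and \<open>edge_A\<close>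
  applies.\<close>

lemma paths_into_A: "(x, es, y) \<in> paths X \<Longrightarrow> y \<in> simplices A 0 \<Longrightarrow> (x, es, y) \<in> paths A"
proof (induction es arbitrary: x)
  case Nil
  then show ?case
    by (simp add: paths_Nil_iff A.sub.paths_Nil_iff)
next
  case (Cons e es)
  then have "(tgt X e, es, y) \<in> paths A" "e \<in> simplices X 1" "x = src X e"
    by (simp_all add: paths_Cons_iff)
  with edge_A[of e] A.sub.paths_endpoints show ?case
    by (auto simp: A.sub.paths_Cons_iff A.src_eq A.tgt_eq)
qed

lemma paths_from_B: "(x, es, y) \<in> paths X \<Longrightarrow> x \<in> simplices B 0 \<Longrightarrow> (x, es, y) \<in> paths B"
proof (induction es arbitrary: x)
  case Nil
  then show ?case
    by (simp add: paths_Nil_iff B.sub.paths_Nil_iff)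
next
  case (Cons e es)
  then have e: "e \<in> simplices B 1" "x = src X e" "(tgt X e, es, y) \<in> paths X"
    by (auto simp add: paths_Cons_iff edge_B)
  then have "tgt X e \<in> simplices B 0"
    using B.sub.tgt_vertex[of e] by (simp add: B.tgt_eq)
  with e Cons.IH show ?case
    by (simp add: B.sub.paths_Cons_iff B.src_eq B.tgt_eq)
qed

text \<open>The crossing edge is the first one whose target is outside \<open>A\<close>; the
  remaining path starts in \<open>B\<close> and therefore stays there.\<close>

lemma crossing_decomposition:
  assumes "(x, es, y) \<in> paths X" "x \<in> simplices A 0" "y \<in> simplices B 0"
  obtains es' \<sigma> fs where "es = es' @ \<sigma> # fs" "\<sigma> \<in> crossing"
    "(x, es', src X \<sigma>) \<in> paths A" "(tgt X \<sigma>, fs, y) \<in> paths B"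
proof -
  have "\<exists>es' \<sigma> fs. es = es' @ \<sigma> # fs \<and> \<sigma> \<in> crossing \<and>
      (x, es', src X \<sigma>) \<in> paths A \<and> (tgt X \<sigma>, fs, y) \<in> paths B"
    using assms
  proof (induction es arbitrary: x)
    case Nil
    then show ?case
      using disjoint by (auto simp: paths_Nil_iff)
  next
    case (Cons e es)
    then have e: "e \<in> simplices X 1" "x = src X e" "(tgt X e, es, y) \<in> paths X"
      by (auto simp add: paths_Cons_iff)
    show ?case
    proof (cases "tgt X e \<in> simplices A 0")
      case True
      with Cons e obtain es' \<sigma> fs where *: "es = es' @ \<sigma> # fs" "\<sigma> \<in> crossing"
        "(tgt X e, es', src X \<sigma>) \<in> paths A" "(tgt X \<sigma>, fs, y) \<in> paths B"
        by blast
      have "(x, e # es', src X \<sigma>) \<in> paths A"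
        using * e edge_A True by (simp add: A.sub.paths_Cons_iff A.src_eq A.tgt_eq)
      with * show ?thesis
        by (intro exI[of _ "e # es'"]) auto
    next
      case False
      with e have "tgt X e \<in> simplices B 0"
        using vertex_cases tgt_vertex by blast
      with e Cons.prems have "e \<in> crossing" "(x, [], src X e) \<in> paths A" "(tgt X e, es, y) \<in> paths B"
        by (auto simp: crossing_def A.sub.paths_Nil_iff paths_from_B)
      then show ?thesis
        by (intro exI[of _ "[]"]) auto
    qed
  qed
  with that show thesis
    by blast
qed

text \<open>Computes the right-hand map of the diagram on representatives.\<close>

lemma composite_class:
  assumes "\<sigma> \<in> crossing" "(x, es, src X \<sigma>) \<in> paths A" "(tgt X \<sigma>, fs, y) \<in> paths B"
  shows "path_comp X (path_incl X (path_class B (tgt X \<sigma>, fs, y)))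
      (path_comp X (path_edge X \<sigma>) (path_incl X (path_class A (x, es, src X \<sigma>))))
    = path_class X (x, es @ \<sigma> # fs, y)"
proof -
  have \<sigma>: "\<sigma> \<in> simplices X 1"
    using assms(1) by (simp add: crossing_def)
  have "(x, es, src X \<sigma>) \<in> paths X" "(tgt X \<sigma>, fs, y) \<in> paths X"
    using assms A.paths_mono B.paths_mono by auto
  moreover from this have "(x, es @ [\<sigma>], tgt X \<sigma>) \<in> paths X"
    by (intro paths_append[OF _ paths_edge[OF \<sigma>]])
  ultimately show ?thesis
    using assms by (simp add: A.path_incl_class B.path_incl_class path_comp_edge(1)[OF \<sigma>] path_comp_class)
qed

text \<open>The edges in the first coordinate start on the side of the square in \<open>A\<close>
  and end on the side in \<open>B\<close>, so they cross. The facts are bundled so that a particular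
  square can be unfolded in all of them at once.\<close>

lemma square_crossing:
  assumes "\<omega> \<in> squares X A B"
  shows "square X \<omega>" "sq_edge \<omega> (0, 0) (1, 0) \<in> crossing" "sq_edge \<omega> (0, 1) (1, 1) \<in> crossing"
    "src X (sq_edge \<omega> (0, 0) (1, 0)) = sq_vertex \<omega> (0, 0)"
    "tgt X (sq_edge \<omega> (0, 0) (1, 0)) = sq_vertex \<omega> (1, 0)"
    "src X (sq_edge \<omega> (0, 1) (1, 1)) = sq_vertex \<omega> (0, 1)"
    "tgt X (sq_edge \<omega> (0, 1) (1, 1)) = sq_vertex \<omega> (1, 1)"
    "src A (sq_edge \<omega> (0, 0) (0, 1)) = sq_vertex \<omega> (0, 0)"
    "tgt A (sq_edge \<omega> (0, 0) (0, 1)) = sq_vertex \<omega> (0, 1)"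
    "src B (sq_edge \<omega> (1, 0) (1, 1)) = sq_vertex \<omega> (1, 0)"
    "tgt B (sq_edge \<omega> (1, 0) (1, 1)) = sq_vertex \<omega> (1, 1)"
    "sq_edge \<omega> (0, 0) (0, 1) \<in> simplices A 1" "sq_edge \<omega> (1, 0) (1, 1) \<in> simplices B 1"
proof -
  show "square X \<omega>"
    using assms by unfold_locales (auto simp: squares_def)
  then interpret square X \<omega> .
  show e: "sq_edge \<omega> (0, 0) (0, 1) \<in> simplices A 1" "sq_edge \<omega> (1, 0) (1, 1) \<in> simplices B 1"
    using assms by (auto simp: squares_def)
  show *: "src X (sq_edge \<omega> (0, 0) (1, 0)) = sq_vertex \<omega> (0, 0)"
    "tgt X (sq_edge \<omega> (0, 0) (1, 0)) = sq_vertex \<omega> (1, 0)"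
    "src X (sq_edge \<omega> (0, 1) (1, 1)) = sq_vertex \<omega> (0, 1)"
    "tgt X (sq_edge \<omega> (0, 1) (1, 1)) = sq_vertex \<omega> (1, 1)"
    "src A (sq_edge \<omega> (0, 0) (0, 1)) = sq_vertex \<omega> (0, 0)"
    "tgt A (sq_edge \<omega> (0, 0) (0, 1)) = sq_vertex \<omega> (0, 1)"
    "src B (sq_edge \<omega> (1, 0) (1, 1)) = sq_vertex \<omega> (1, 0)"
    "tgt B (sq_edge \<omega> (1, 0) (1, 1)) = sq_vertex \<omega> (1, 1)"
    by (simp_all add: edge A.src_eq A.tgt_eq B.src_eq B.tgt_eq)
  show "sq_edge \<omega> (0, 0) (1, 0) \<in> crossing" "sq_edge \<omega> (0, 1) (1, 1) \<in> crossing"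
    using A.sub.src_vertex[OF e(1)] A.sub.tgt_vertex[OF e(1)] B.sub.src_vertex[OF e(2)]
      B.sub.tgt_vertex[OF e(2)]
    by (simp_all add: crossing_def edge *)
qed

text \<open>Induction over the generators, where the assumption on \<open>h\<close> is the
  coequalizing condition, one instance for each square. The endpoints are fixed by equations, which
  \<open>path_rel_paths\<close> carries through symmetry and transitivity.\<close>

lemma split_invariant:
  assumes "(w, w') \<in> path_rel X" "fst w = u" "snd (snd w) = v"
    and u: "u \<in> simplices A 0" and v: "v \<in> simplices B 0"
    and h: "\<And>\<omega> p q. \<omega> \<in> squares X A B \<Longrightarrow> p \<in> path_hom A u (sq_vertex \<omega> (0, 0)) \<Longrightarrow>
      q \<in> path_hom B (sq_vertex \<omega> (1, 1)) v \<Longrightarrow>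
      h (sq_edge \<omega> (0, 0) (1, 0), p, path_comp B q (path_edge B (sq_edge \<omega> (1, 0) (1, 1)))) =
      h (sq_edge \<omega> (0, 1) (1, 1), path_comp A (path_edge A (sq_edge \<omega> (0, 0) (0, 1))) p, q)"
  shows "h (split w) = h (split w')"
  using assms(1-3)
proof (induction rule: path_rel.induct)
  case (refl w)
  show ?case ..
next
  case (sym w w')
  then show ?case
    using path_rel_paths[OF sym.hyps] by simp
next
  case (trans w w' w'')
  then show ?case
    using path_rel_paths[OF trans.hyps(1)] by simp
next
  case (degenerate z x es fs y)
  then have [simp]: "x = u" "y = v"
    by simp_all
  from degenerate(1) consider "z \<in> simplices A 0" | "z \<in> simplices B 0"
    using vertex_cases by blast
  then show ?case
  proof cases
    case 1
    \<comment> \<open>For \<open>z\<close> in \<open>A\<close> the crossing edge lies in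
      \<open>fs\<close>, so the degeneracy changes only the part in \<open>A\<close>. For
      \<open>z\<close> in \<open>B\<close> it lies in \<open>es\<close>, and only the part in
      \<open>B\<close> changes.\<close>
    obtain fs' \<sigma> gs where *: "fs = fs' @ \<sigma> # gs" "\<sigma> \<in> crossing"
      "(z, fs', src X \<sigma>) \<in> paths A" "(tgt X \<sigma>, gs, v) \<in> paths B"
      using crossing_decomposition[OF degenerate(3)] 1 v by auto
    have es: "(u, es, z) \<in> paths A"
      using paths_into_A degenerate(2) 1 by simp
    have "(z, [degen A 0 0 z], z) \<in> paths A"
      using A.sub.paths_edge[OF A.sub.degen_edge[OF 1]]
      by (simp add: A.sub.src_degen[OF 1] A.sub.tgt_degen[OF 1])
    then have "(u, es @ [degen X 0 0 z] @ fs', src X \<sigma>) \<in> paths A"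
      using A.sub.paths_append[OF es A.sub.paths_append[OF _ *(3)], of "[degen X 0 0 z]"]
      by (simp add: A.degen_eq)
    then have "split (u, es @ [degen X 0 0 z] @ fs, v) = split (u, es @ fs, v)"
      using split_append[OF _ *(2), of u "es @ [degen X 0 0 z] @ fs'"]
        split_append[OF A.sub.paths_append[OF es *(3)] *(2)]
        A.sub.path_class_degenerate[OF es *(3)]
      by (simp add: * A.degen_eq)
    then show ?thesis
      by simp
  next
    case 2
    obtain es' \<sigma> gs where *: "es = es' @ \<sigma> # gs" "\<sigma> \<in> crossing"
      "(u, es', src X \<sigma>) \<in> paths A" "(tgt X \<sigma>, gs, z) \<in> paths B"
      using crossing_decomposition[OF degenerate(2)] 2 u by auto
    have "(z, fs, v) \<in> paths B"
      using paths_from_B degenerate(3) 2 by simp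
    then have "split (u, es @ [degen X 0 0 z] @ fs, v) = split (u, es @ fs, v)"
      using B.sub.path_class_degenerate[OF *(4)]
      by (simp add: * split_append[OF *(3,2)] B.degen_eq)
    then show ?thesis
      by simp
  qed
next
  case (triangle \<tau> x es fs y)
  let ?d0 = "face X 2 0 \<tau>" and ?d1 = "face X 2 1 \<tau>" and ?d2 = "face X 2 2 \<tau>"
  have [simp]: "x = u" "y = v"
    using triangle by simp_all
  have d: "?d0 \<in> simplices X 1" "?d1 \<in> simplices X 1" "?d2 \<in> simplices X 1"
    using face_edge[OF triangle(1)] by simp_all
  have tri: "src X ?d2 = src X ?d1" "tgt X ?d0 = tgt X ?d1" "src X ?d0 = tgt X ?d2"
    using src_face_1 tgt_face_1 tgt_face_2 triangle(1) by simp_all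
  \<comment> \<open>Four cases: the last vertex is in \<open>A\<close>, and then so is the triangle;
    the first vertex is in \<open>B\<close>, and then so is the triangle; or the long edge
    \<open>?d1\<close> crosses, with the middle vertex \<open>tgt X ?d2\<close> on one side or the
    other.\<close>
  consider "tgt X ?d1 \<in> simplices A 0" | "src X ?d1 \<in> simplices B 0"
    | "src X ?d1 \<in> simplices A 0" "tgt X ?d1 \<in> simplices B 0" "tgt X ?d2 \<in> simplices A 0"
    | "src X ?d1 \<in> simplices A 0" "tgt X ?d1 \<in> simplices B 0" "tgt X ?d2 \<in> simplices B 0"
    using vertex_cases src_vertex tgt_vertex d by blast
  then show ?case
  proof cases
    case 1
    then have \<tau>: "\<tau> \<in> simplices A 2"
      using triangle_A triangle(1) by simp
    have d1: "src X ?d1 \<in> simplices A 0"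
      using A.sub.src_vertex[OF A.sub.face_edge[OF \<tau>, of 1]] by (simp add: A.src_eq A.face_eq)
    obtain fs' \<sigma> gs where *: "fs = fs' @ \<sigma> # gs" "\<sigma> \<in> crossing"
      "(tgt X ?d1, fs', src X \<sigma>) \<in> paths A" "(tgt X \<sigma>, gs, v) \<in> paths B"
      using crossing_decomposition[OF triangle(3)] 1 v by auto
    have es: "(u, es, src X ?d1) \<in> paths A"
      using paths_into_A triangle(2) d1 by simp
    \<comment> \<open>The triangle relation of \<open>A\<close>, rewritten with the operators of
      \<open>X\<close>; it affects only the part of the path before \<sigma>.\<close>
    note rel = path_rel.triangle[of \<tau> A u es fs' "src X \<sigma>",
        unfolded A.src_eq A.tgt_eq A.face_eq, OF \<tau> es *(3)]
    from A.sub.path_rel_paths[OF rel] A.sub.path_class_eqI[OF rel] show ?thesis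
      using split_append[OF _ *(2), of u "es @ [?d1] @ fs'" "src X \<sigma>"]
        split_append[OF _ *(2), of u "es @ [?d2, ?d0] @ fs'" "src X \<sigma>"]
      by (simp add: *)
  next
    case 2
    then have \<tau>: "\<tau> \<in> simplices B 2"
      using triangle_B triangle(1) by simp
    obtain es' \<sigma> gs where *: "es = es' @ \<sigma> # gs" "\<sigma> \<in> crossing"
      "(u, es', src X \<sigma>) \<in> paths A" "(tgt X \<sigma>, gs, src X ?d1) \<in> paths B"
      using crossing_decomposition[OF triangle(2)] 2 u by auto
    have "tgt X ?d1 \<in> simplices B 0"
      using B.sub.tgt_vertex[OF B.sub.face_edge[OF \<tau>, of 1]] by (simp add: B.tgt_eq B.face_eq)
    then have fs: "(tgt X ?d1, fs, v) \<in> paths B"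
      using paths_from_B triangle(3) by simp
    from B.sub.path_class_eqI[OF path_rel.triangle[of \<tau> B "tgt X \<sigma>" gs fs v,
        unfolded B.src_eq B.tgt_eq B.face_eq, OF \<tau> *(4) fs]] show ?thesis
      by (simp add: * split_append[OF *(3,2)])
  next
    case 3
    have es: "(u, es, src X ?d1) \<in> paths A" and fs: "(tgt X ?d1, fs, v) \<in> paths B"
      using paths_into_A paths_from_B triangle(2,3) 3 by simp_all
    have d2: "?d2 \<in> simplices A 1"
      using edge_A d 3 by simp
    have deg: "degen X 0 0 (tgt X ?d1) \<in> simplices B 1"
      "src B (degen X 0 0 (tgt X ?d1)) = tgt X ?d1" "tgt B (degen X 0 0 (tgt X ?d1)) = tgt X ?d1"
      using B.sub.degen_edge B.sub.src_degen B.sub.tgt_degen 3 by (simp_all add: B.degen_eq)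
    \<comment> \<open>The side in \<open>B\<close> is collapsed to the last vertex. Through this
      square \<open>h\<close> identifies the splitting at \<open>?d1\<close> with the one at
      \<open>?d0\<close>, in which \<open>?d2\<close> has joined the part in
      \<open>A\<close>.\<close>
    obtain \<omega> where \<omega>: "\<omega> \<in> squares X A B" "sq_edge \<omega> (0, 0) (0, 1) = ?d2"
      "sq_edge \<omega> (0, 1) (1, 1) = ?d0" "sq_edge \<omega> (0, 0) (1, 0) = ?d1"
      "sq_edge \<omega> (1, 0) (1, 1) = degen X 0 0 (tgt X ?d1)"
      using square_A[OF triangle(1) d2 3(2)] by blast
    note vertex = square_crossing[OF \<omega>(1), unfolded \<omega>]
    \<comment> \<open>The collapsed side is an identity of the path category of
      \<open>B\<close>.\<close>
    have "path_comp B (path_class B (tgt X ?d1, fs, v)) (path_edge B (degen X 0 0 (tgt X ?d1)))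
        = path_class B (tgt X ?d1, fs, v)"
      using B.sub.path_comp_edge(2)[OF deg(1), of fs v] fs deg
        B.sub.path_class_degenerate[of "tgt X ?d1" "[]" "tgt X ?d1" fs v] 3
      by (simp add: B.sub.paths_Nil_iff B.degen_eq)
    moreover have "path_comp A (path_edge A ?d2) (path_class A (u, es, src X ?d1))
        = path_class A (u, es @ [?d2], tgt X ?d2)"
      using A.sub.path_comp_edge(1)[OF d2, of u es] es by (simp add: A.src_eq A.tgt_eq tri)
    moreover have "path_class A (u, es, src X ?d1) \<in> path_hom A u (sq_vertex \<omega> (0, 0))"
      "path_class B (tgt X ?d1, fs, v) \<in> path_hom B (sq_vertex \<omega> (1, 1)) v"
      using es fs vertex tri by (auto simp: A.sub.path_hom_iff B.sub.path_hom_iff)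
    ultimately have "h (?d1, path_class A (u, es, src X ?d1), path_class B (tgt X ?d1, fs, v))
        = h (?d0, path_class A (u, es @ [?d2], tgt X ?d2), path_class B (tgt X ?d1, fs, v))"
      using h[OF \<omega>(1), of "path_class A (u, es, src X ?d1)" "path_class B (tgt X ?d1, fs, v)"] \<omega>
      by simp
    moreover have "(u, es @ [?d2], tgt X ?d2) \<in> paths A"
      using A.sub.paths_append[OF es] A.sub.paths_edge[OF d2] by (simp add: A.src_eq A.tgt_eq tri)
    ultimately show ?thesis
      using split_append[OF es vertex(2)] split_append[of u "es @ [?d2]" _ ?d0, OF _ vertex(3)]
      by (simp add: tri)
  next
    case 4
    have es: "(u, es, src X ?d1) \<in> paths A" and fs: "(tgt X ?d1, fs, v) \<in> paths B"
      using paths_into_A paths_from_B triangle(2,3) 4 by simp_all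
    have d0: "?d0 \<in> simplices B 1"
      using edge_B d 4 tri by simp
    have deg: "degen X 0 0 (src X ?d1) \<in> simplices A 1"
      "src A (degen X 0 0 (src X ?d1)) = src X ?d1" "tgt A (degen X 0 0 (src X ?d1)) = src X ?d1"
      using A.sub.degen_edge A.sub.src_degen A.sub.tgt_degen 4 by (simp_all add: A.degen_eq)
    \<comment> \<open>Dually, the side in \<open>A\<close> is collapsed to the first vertex, and
      \<open>h\<close> identifies the splitting at \<open>?d2\<close>, where \<open>?d0\<close>
      belongs to the part in \<open>B\<close>, with the one at \<open>?d1\<close>.\<close>
    obtain \<omega> where \<omega>: "\<omega> \<in> squares X A B" "sq_edge \<omega> (0, 0) (0, 1) = degen X 0 0 (src X ?d1)"
      "sq_edge \<omega> (0, 1) (1, 1) = ?d1" "sq_edge \<omega> (0, 0) (1, 0) = ?d2"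
      "sq_edge \<omega> (1, 0) (1, 1) = ?d0"
      using square_B[OF triangle(1) 4(1) d0] by blast
    note vertex = square_crossing[OF \<omega>(1), unfolded \<omega>]
    have "path_comp A (path_edge A (degen X 0 0 (src X ?d1))) (path_class A (u, es, src X ?d1))
        = path_class A (u, es, src X ?d1)"
      using A.sub.path_comp_edge(1)[OF deg(1), of u es] es deg
        A.sub.path_class_degenerate[of u es "src X ?d1" "[]" "src X ?d1"] 4
      by (simp add: A.sub.paths_Nil_iff A.degen_eq)
    moreover have "path_comp B (path_class B (tgt X ?d1, fs, v)) (path_edge B ?d0)
        = path_class B (tgt X ?d2, ?d0 # fs, v)"
      using B.sub.path_comp_edge(2)[OF d0, of fs v] fs by (simp add: B.src_eq B.tgt_eq tri)
    moreover have "path_class A (u, es, src X ?d1) \<in> path_hom A u (sq_vertex \<omega> (0, 0))"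
      "path_class B (tgt X ?d1, fs, v) \<in> path_hom B (sq_vertex \<omega> (1, 1)) v"
      using es fs vertex tri by (auto simp: A.sub.path_hom_iff B.sub.path_hom_iff)
    ultimately have "h (?d2, path_class A (u, es, src X ?d1), path_class B (tgt X ?d2, ?d0 # fs, v))
        = h (?d1, path_class A (u, es, src X ?d1), path_class B (tgt X ?d1, fs, v))"
      using h[OF \<omega>(1), of "path_class A (u, es, src X ?d1)" "path_class B (tgt X ?d1, fs, v)"] \<omega>
      by simp
    then show ?thesis
      using split_append[OF es vertex(2)] split_append[OF es vertex(3)] by (simp add: tri)
  qed
qed

text \<open>Through \<open>split\<close>, the paths from \<open>u\<close> to \<open>v\<close> map
  onto the middle coproduct, and following with the right-hand map takes each path to its class.
  Both existence and uniqueness of the factorization are read off on paths.\<close>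

theorem coequalizer:
  assumes u: "u \<in> simplices A 0" and v: "v \<in> simplices B 0"
  shows "is_coequalizer TYPE('z)
    (SIGMA \<omega> : squares X A B.
       path_hom A u (sq_vertex \<omega> (0, 0)) \<times> path_hom B (sq_vertex \<omega> (1, 1)) v)
    (SIGMA \<sigma> : crossing. path_hom A u (src X \<sigma>) \<times> path_hom B (tgt X \<sigma>) v)
    (path_hom X u v)
    (\<lambda>(\<omega>, p, q). (sq_edge \<omega> (0, 0) (1, 0),
       p, path_comp B q (path_edge B (sq_edge \<omega> (1, 0) (1, 1)))))
    (\<lambda>(\<omega>, p, q). (sq_edge \<omega> (0, 1) (1, 1),
       path_comp A (path_edge A (sq_edge \<omega> (0, 0) (0, 1))) p, q))
    (\<lambda>(\<sigma>, p, q). path_comp X (path_incl X q) (path_comp X (path_edge X \<sigma>) (path_incl X p)))"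
    (is "is_coequalizer _ ?R ?E ?C ?f ?g ?e")
proof -
  have e: "?e (split (u, es, v)) = path_class X (u, es, v)" "split (u, es, v) \<in> ?E"
    if path: "(u, es, v) \<in> paths X" for es
  proof -
    obtain es' \<sigma> fs where *: "es = es' @ \<sigma> # fs" "\<sigma> \<in> crossing"
      "(u, es', src X \<sigma>) \<in> paths A" "(tgt X \<sigma>, fs, v) \<in> paths B"
      using crossing_decomposition[OF path u v] .
    then show "?e (split (u, es, v)) = path_class X (u, es, v)" "split (u, es, v) \<in> ?E"
      by (auto simp: split_append composite_class A.sub.path_hom_iff B.sub.path_hom_iff)
  qed
  \<comment> \<open>Concatenating representatives around \<sigma> gives a path whose splitting is
    the given element.\<close>
  have E: "\<exists>es. (u, es, v) \<in> paths X \<and> split (u, es, v) = x" if "x \<in> ?E" for x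
  proof -
    from that obtain \<sigma> es fs where *: "\<sigma> \<in> crossing" "(u, es, src X \<sigma>) \<in> paths A"
      "(tgt X \<sigma>, fs, v) \<in> paths B"
      "x = (\<sigma>, path_class A (u, es, src X \<sigma>), path_class B (tgt X \<sigma>, fs, v))"
      by (auto simp: A.sub.path_hom_iff B.sub.path_hom_iff)
    then have "(u, es @ \<sigma> # fs, v) \<in> paths X"
      using A.paths_mono B.paths_mono by (auto simp: crossing_def paths_Cons_iff intro!: paths_append[of u es "src X \<sigma>"])
    with * show ?thesis
      by (intro exI[of _ "es @ \<sigma> # fs"]) (simp add: split_append)
  qed
  have R: "?f r \<in> ?E \<and> ?g r \<in> ?E \<and> ?e (?f r) = ?e (?g r)" if "r \<in> ?R" for r
  proof -
    from that obtain \<omega> es fs where r: "\<omega> \<in> squares X A B"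
      "(u, es, sq_vertex \<omega> (0, 0)) \<in> paths A" "(sq_vertex \<omega> (1, 1), fs, v) \<in> paths B"
      "r = (\<omega>, path_class A (u, es, sq_vertex \<omega> (0, 0)), path_class B (sq_vertex \<omega> (1, 1), fs, v))"
      by (auto simp: A.sub.path_hom_iff B.sub.path_hom_iff)
    note sq = square_crossing[OF r(1)]
    let ?es = "es @ [sq_edge \<omega> (0, 0) (0, 1)]" and ?fs = "sq_edge \<omega> (1, 0) (1, 1) # fs"
    have es: "(u, ?es, sq_vertex \<omega> (0, 1)) \<in> paths A"
      using A.sub.paths_append[OF r(2)] A.sub.paths_edge[OF sq(12)] sq by simp
    have fs: "(sq_vertex \<omega> (1, 0), ?fs, v) \<in> paths B"
      using r(3) sq by (simp add: B.sub.paths_Cons_iff)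
    have f: "?f r = (sq_edge \<omega> (0, 0) (1, 0),
        path_class A (u, es, sq_vertex \<omega> (0, 0)), path_class B (sq_vertex \<omega> (1, 0), ?fs, v))"
      using B.sub.path_comp_edge(2)[OF sq(13), of fs v] r sq by simp
    have g: "?g r = (sq_edge \<omega> (0, 1) (1, 1),
        path_class A (u, ?es, sq_vertex \<omega> (0, 1)), path_class B (sq_vertex \<omega> (1, 1), fs, v))"
      using A.sub.path_comp_edge(1)[OF sq(12), of u es] r sq by simp
    \<comment> \<open>The two images are represented by paths going around the square in the two
      ways.\<close>
    have "?e (?f r) = path_class X (u, es @ sq_edge \<omega> (0, 0) (1, 0) # ?fs, v)"
      using composite_class[OF sq(2), of u es ?fs v] r fs sq unfolding f by simp
    also have "\<dots> = path_class X (u, ?es @ sq_edge \<omega> (0, 1) (1, 1) # fs, v)"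
      using square.path_class_square[OF sq(1)] A.paths_mono[OF r(2)] B.paths_mono[OF r(3)] by simp
    also have "\<dots> = ?e (?g r)"
      using composite_class[OF sq(3), of u ?es fs v] r es sq unfolding g by simp
    finally have "?e (?f r) = ?e (?g r)" .
    moreover have "?f r \<in> ?E" "?g r \<in> ?E"
      unfolding f g using r(2,3) es fs sq(2-7) by (auto simp: A.sub.path_hom_iff B.sub.path_hom_iff)
    ultimately show ?thesis
      by blast
  qed
  have C: "?e x \<in> ?C" if "x \<in> ?E" for x
    using E[OF that] e by (auto simp: path_hom_iff)
  have universal: "\<exists>!k. k \<in> ?C \<rightarrow>\<^sub>E Z \<and> (\<forall>x\<in>?E. k (?e x) = h x)"
    if h: "h \<in> ?E \<rightarrow> Z" "\<And>r. r \<in> ?R \<Longrightarrow> h (?f r) = h (?g r)" for Z :: "'z set" and h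
  proof -
    have inv: "h (split (u, es, v)) = h (split w)" if "((u, es, v), w) \<in> path_rel X" for es w
    proof (rule split_invariant[OF that _ _ u v])
      fix \<omega> p q
      assume "\<omega> \<in> squares X A B" "p \<in> path_hom A u (sq_vertex \<omega> (0, 0))"
        "q \<in> path_hom B (sq_vertex \<omega> (1, 1)) v"
      then show "h (sq_edge \<omega> (0, 0) (1, 0), p, path_comp B q (path_edge B (sq_edge \<omega> (1, 0) (1, 1)))) =
          h (sq_edge \<omega> (0, 1) (1, 1), path_comp A (path_edge A (sq_edge \<omega> (0, 0) (0, 1))) p, q)"
        using h(2)[of "(\<omega>, p, q)"] by simp
    qed simp_all
    \<comment> \<open>The representative chosen by \<open>SOME\<close> does not matter, by
      \<open>inv\<close>. The restriction to \<open>?C\<close> makes \<open>k\<close> extensional,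
      as the uniqueness claim demands.\<close>
    define k where "k = restrict (\<lambda>c. h (split (SOME w. w \<in> c))) ?C"
    have k: "k (path_class X (u, es, v)) = h (split (u, es, v))" if "(u, es, v) \<in> paths X" for es
    proof -
      have "(u, es, v) \<in> path_class X (u, es, v)"
        using that by (simp add: mem_path_class path_rel.refl)
      then have "((u, es, v), SOME w. w \<in> path_class X (u, es, v)) \<in> path_rel X"
        unfolding mem_path_class[symmetric] by (rule someI)
      with inv that show ?thesis
        by (auto simp: k_def path_hom_iff)
    qed
    show ?thesis
    proof (rule ex1I)
      have "k c \<in> Z" if "c \<in> ?C" for c
        using that k e(2) h(1) by (auto simp: path_hom_iff)
      moreover have "k (?e x) = h x" if "x \<in> ?E" for x
        using E[OF that] e(1) k by auto
      ultimately show "k \<in> ?C \<rightarrow>\<^sub>E Z \<and> (\<forall>x\<in>?E. k (?e x) = h x)"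
        by (auto simp: k_def)
    next
      fix k'
      assume k': "k' \<in> ?C \<rightarrow>\<^sub>E Z \<and> (\<forall>x\<in>?E. k' (?e x) = h x)"
      show "k' = k"
      proof (rule extensionalityI[of _ ?C])
        show "k' \<in> extensional ?C" "k \<in> extensional ?C"
          using k' by (auto simp: k_def PiE_def)
        fix c
        assume "c \<in> ?C"
        then obtain es where es: "(u, es, v) \<in> paths X" "c = path_class X (u, es, v)"
          by (auto simp: path_hom_iff)
        \<comment> \<open>Every morphism is the image under \<open>?e\<close> of a splitting, so the
          value of \<open>k'\<close> on it is forced.\<close>
        have "k' (?e (split (u, es, v))) = h (split (u, es, v))"
          by (rule bspec[OF conjunct2[OF k'] e(2)[OF es(1)]])
        then show "k' c = k c"
          unfolding e(1)[OF es(1)] k[OF es(1)] es(2) .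
      qed
    qed
  qed
  show ?thesis
    unfolding is_coequalizer_def
  proof (intro conjI ballI allI impI)
    show "?f \<in> ?R \<rightarrow> ?E" "?g \<in> ?R \<rightarrow> ?E" "?e \<in> ?E \<rightarrow> ?C"
      by (intro Pi_I, erule R[THEN conjunct1] R[THEN conjunct2, THEN conjunct1] C)+
  next
    fix r
    assume "r \<in> ?R"
    then show "?e (?f r) = ?e (?g r)"
      by (rule R[THEN conjunct2, THEN conjunct2])
  next
    fix Z :: "'z set" and h
    assume "h \<in> ?E \<rightarrow> Z \<and> (\<forall>r\<in>?R. h (?f r) = h (?g r))"
    then show "\<exists>!k. k \<in> ?C \<rightarrow>\<^sub>E Z \<and> (\<forall>x\<in>?E. k (?e x) = h x)"
      by (elim conjE) (rule universal, assumption, erule bspec)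
  qed
qed

end


section \<open>Triangulations of cubical complexes\<close>

text \<open>Vertices are handled as intervals \<open>{F..F}\<close>, so that the facts about cells
  apply to them.\<close>

declare atLeastAtMost_singleton [simp del]

section \<open>Cells as intervals, and levels\<close>

lemma interval_eq_iff: "C \<subseteq> D \<Longrightarrow> {C..D} = {C'..D'} \<longleftrightarrow> C = C' \<and> D = D'" for C D :: "'a set"
  by (simp add: Icc_eq_Icc)

lemma cubical_complex_cell:
  assumes "cubical_complex n K" "c \<in> K"
  obtains C D where "C \<subseteq> D" "D \<subseteq> {1..n}" "c = {C..D}"
  using bspec[OF conjunct1[OF assms(1)[unfolded cubical_complex_def]] assms(2)]
  by (elim exE conjE)

lemma cubical_complex_ambient:
  assumes "cubical_complex n K" "{F..G} \<in> K" "F \<subseteq> G"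
  shows "G \<subseteq> {1..n}"
proof -
  obtain C D where "C \<subseteq> D" "D \<subseteq> {1..n}" "{F..G} = {C..D}"
    using cubical_complex_cell[OF assms(1,2)] .
  with assms(3) show ?thesis
    by (simp add: interval_eq_iff)
qed

lemma cubical_complex_finite: "cubical_complex n K \<Longrightarrow> {F..G} \<in> K \<Longrightarrow> F \<subseteq> G \<Longrightarrow> finite G"
  by (meson cubical_complex_ambient finite_atLeastAtMost finite_subset)

lemma cubical_complex_card: "cubical_complex n K \<Longrightarrow> {F..G} \<in> K \<Longrightarrow> F \<subseteq> G \<Longrightarrow> card G \<le> n"
  using card_mono[OF _ cubical_complex_ambient] by fastforce

lemma cubical_complex_subinterval:
  assumes "cubical_complex n K" "{C..D} \<in> K" "C \<subseteq> F" "F \<subseteq> G" "G \<subseteq> D"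
  shows "{F..G} \<in> K"
  using conjunct2[OF assms(1)[unfolded cubical_complex_def], rule_format, of C D F G] assms(2-) by simp

text \<open>Cells consist of finite sets, so cardinality is monotone on a cell and the bounds need
  checking only at its two ends.\<close>

lemma interval_in_level_iff:
  assumes "cubical_complex n K" "F \<subseteq> G"
  shows "{F..G} \<in> level K r s \<longleftrightarrow> {F..G} \<in> K \<and> r \<le> card F \<and> card G \<le> s"
proof -
  have "card F \<le> card H \<and> card H \<le> card G" if "{F..G} \<in> K" "F \<subseteq> H" "H \<subseteq> G" for H
    using cubical_complex_finite[OF assms(1) that(1) assms(2)] that
    by (auto intro!: card_mono dest: finite_subset)
  then have "r \<le> card H \<and> card H \<le> s"
    if "{F..G} \<in> K" "F \<subseteq> H" "H \<subseteq> G" "r \<le> card F" "card G \<le> s" for H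
    using that le_trans by blast
  moreover have "F \<in> {F..G}" "G \<in> {F..G}"
    using assms(2) by simp_all
  ultimately show ?thesis
    unfolding level_def mem_Collect_eq Ball_def atLeastAtMost_iff by (intro iffI conjI allI impI) simp_all
qed

lemma cubical_complex_level:
  assumes "cubical_complex n K"
  shows "cubical_complex n (level K r s)"
  unfolding cubical_complex_def
proof (intro conjI allI impI ballI)
  fix c
  assume "c \<in> level K r s"
  then have "c \<in> K"
    by (simp add: level_def)
  then show "\<exists>C D. C \<subseteq> D \<and> D \<subseteq> {1..n} \<and> c = {C..D}"
    using cubical_complex_cell[OF assms] by metis
next
  fix C D C' D'
  assume *: "{C..D} \<in> level K r s \<and> C \<subseteq> C' \<and> C' \<subseteq> D' \<and> D' \<subseteq> D"
  then have "{C'..D'} \<in> K"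
    using cubical_complex_subinterval[OF assms] by (auto simp: level_def)
  moreover have "{C'..D'} \<subseteq> {C..D}"
    using * by (simp add: atLeastatMost_subset_iff)
  ultimately show "{C'..D'} \<in> level K r s"
    using * unfolding level_def by blast
qed

section \<open>Low-dimensional simplices and squares of a triangulation\<close>

lemma face_triangulation: "face (triangulation K) = face (nerve UNIV)"
  and degen_triangulation: "degen (triangulation K) = degen (nerve UNIV)"
  by (simp_all add: triangulation_def)

lemma src_triangulation: "src (triangulation K) [F, G] = [F]"
  and tgt_triangulation: "tgt (triangulation K) [F, G] = [G]"
  by (simp_all add: src_def tgt_def triangulation_def nerve_def One_nat_def)

lemma simplices_triangulation_mono:
  "K \<subseteq> K' \<Longrightarrow> simplices (triangulation K) k \<subseteq> simplices (triangulation K') k"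
  by (auto simp: triangulation_def)

text \<open>Closure under subintervals replaces an unspecified cell containing both vertices by the
  interval that they span.\<close>

lemma ex_cell_iff:
  assumes "cubical_complex n K" "F \<subseteq> G"
  shows "(\<exists>c\<in>K. F \<in> c \<and> G \<in> c) \<longleftrightarrow> {F..G} \<in> K"
proof
  assume "\<exists>c\<in>K. F \<in> c \<and> G \<in> c"
  then obtain C D where "{C..D} \<in> K" "F \<in> {C..D}" "G \<in> {C..D}"
    by (metis cubical_complex_cell[OF assms(1)])
  with cubical_complex_subinterval[OF assms(1)] assms(2) show "{F..G} \<in> K"
    by simp
next
  assume "{F..G} \<in> K"
  with assms(2) show "\<exists>c\<in>K. F \<in> c \<and> G \<in> c"
    by (intro bexI[of _ "{F..G}"]) simp_all
qed

lemma cell_convex: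
  assumes "cubical_complex n K" "c \<in> K" "F \<in> c" "H \<in> c" "F \<subseteq> G" "G \<subseteq> H"
  shows "G \<in> c"
proof -
  obtain C D where "c = {C..D}"
    using cubical_complex_cell[OF assms(1,2)] by metis
  with assms show ?thesis
    by auto
qed

lemma vertices_triangulation:
  assumes "cubical_complex n K"
  shows "xs \<in> simplices (triangulation K) 0 \<longleftrightarrow> (\<exists>F. xs = [F] \<and> {F..F} \<in> K)"
proof -
  have "xs \<in> simplices (triangulation K) 0 \<longleftrightarrow> (\<exists>F. xs = [F] \<and> (\<exists>c\<in>K. F \<in> c \<and> F \<in> c))"
    by (auto simp: triangulation_def nerve_def length_Suc_conv)
  then show ?thesis
    by (simp only: ex_cell_iff[OF assms order_refl])
qed

lemma edges_triangulation:
  assumes "cubical_complex n K"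
  shows "xs \<in> simplices (triangulation K) 1 \<longleftrightarrow> (\<exists>F G. xs = [F, G] \<and> F \<subseteq> G \<and> {F..G} \<in> K)"
proof -
  have "xs \<in> simplices (triangulation K) 1 \<longleftrightarrow>
      (\<exists>F G. xs = [F, G] \<and> F \<subseteq> G \<and> (\<exists>c\<in>K. F \<in> c \<and> G \<in> c))"
    by (auto simp: triangulation_def nerve_def length_Suc_conv One_nat_def)
  then show ?thesis
    by (simp only: ex_cell_iff[OF assms] cong: conj_cong)
qed

text \<open>Cells are order convex, so the middle vertex imposes no condition beyond lying between
  the outer two.\<close>

lemma triangles_triangulation:
  assumes "cubical_complex n K"
  shows "xs \<in> simplices (triangulation K) 2 \<longleftrightarrow>
    (\<exists>F G H. xs = [F, G, H] \<and> F \<subseteq> G \<and> G \<subseteq> H \<and> {F..H} \<in> K)"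
proof -
  have "xs \<in> simplices (triangulation K) 2 \<longleftrightarrow>
      (\<exists>F G H. xs = [F, G, H] \<and> F \<subseteq> G \<and> G \<subseteq> H \<and> (\<exists>c\<in>K. F \<in> c \<and> H \<in> c))" (is "_ = ?R")
  proof
    assume "xs \<in> simplices (triangulation K) 2"
    then show ?R
      by (auto simp: triangulation_def nerve_def length_Suc_conv numeral_2_eq_2)
  next
    assume ?R
    then obtain F G H c where "xs = [F, G, H]" "F \<subseteq> G" "G \<subseteq> H" "c \<in> K" "F \<in> c" "H \<in> c"
      by blast
    with cell_convex[OF assms, of c F H G] show "xs \<in> simplices (triangulation K) 2"
      by (auto simp: triangulation_def nerve_def)
  qed
  moreover have "(F \<subseteq> G \<and> G \<subseteq> H \<and> (\<exists>c\<in>K. F \<in> c \<and> H \<in> c)) \<longleftrightarrow> (F \<subseteq> G \<and> G \<subseteq> H \<and> {F..H} \<in> K)"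
    for F G H
    using ex_cell_iff[OF assms, of F H] by blast
  ultimately show ?thesis
    by simp
qed

lemma faces_triangle:
  "face (triangulation K) 2 0 [F, G, H] = [G, H]"
  "face (triangulation K) 2 1 [F, G, H] = [F, H]"
  "face (triangulation K) 2 2 [F, G, H] = [F, G]"
  by (simp_all add: face_triangulation nerve_def One_nat_def)

lemma degen_vertex: "degen (triangulation K) 0 0 [F] = [F, F]"
  by (simp add: degen_triangulation nerve_def)

lemma truncated_sset_triangulation:
  assumes K: "cubical_complex n K"
  shows "truncated_sset (triangulation K)"
proof
  note [simp] = vertices_triangulation[OF K] edges_triangulation[OF K] triangles_triangulation[OF K]
    src_triangulation tgt_triangulation faces_triangle degen_vertex
  note sub = cubical_complex_subinterval[OF K]
  fix e z \<tau>
  show "e \<in> simplices (triangulation K) 1 \<Longrightarrow> src (triangulation K) e \<in> simplices (triangulation K) 0"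
    "e \<in> simplices (triangulation K) 1 \<Longrightarrow> tgt (triangulation K) e \<in> simplices (triangulation K) 0"
    by (auto intro: sub)
  show "z \<in> simplices (triangulation K) 0 \<Longrightarrow> degen (triangulation K) 0 0 z \<in> simplices (triangulation K) 1"
    "z \<in> simplices (triangulation K) 0 \<Longrightarrow> src (triangulation K) (degen (triangulation K) 0 0 z) = z"
    "z \<in> simplices (triangulation K) 0 \<Longrightarrow> tgt (triangulation K) (degen (triangulation K) 0 0 z) = z"
    by auto
  assume \<tau>: "\<tau> \<in> simplices (triangulation K) 2"
  have i: "i = 0 \<or> i = 1 \<or> i = 2" if "i \<le> 2" for i :: nat
    using that by linarith
  show "face (triangulation K) 2 i \<tau> \<in> simplices (triangulation K) 1" if "i \<le> 2" for i
    using i[OF that] \<tau> by (auto intro: sub)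
  show "src (triangulation K) (face (triangulation K) 2 1 \<tau>) = src (triangulation K) (face (triangulation K) 2 2 \<tau>)"
    "tgt (triangulation K) (face (triangulation K) 2 1 \<tau>) = tgt (triangulation K) (face (triangulation K) 2 0 \<tau>)"
    "tgt (triangulation K) (face (triangulation K) 2 2 \<tau>) = src (triangulation K) (face (triangulation K) 2 0 \<tau>)"
    using \<tau> by auto
qed

lemma truncated_subset_triangulation:
  assumes "cubical_complex n A" "cubical_complex n K" "A \<subseteq> K"
  shows "truncated_subset (triangulation A) (triangulation K)"
  using assms truncated_sset_triangulation simplices_triangulation_mono
  by (simp add: truncated_subset_def truncated_subset_axioms_def face_triangulation degen_triangulation)

text \<open>The map of nerves induced by a vertex map, applied entrywise to a chain of pairs; the
  restriction meets the extensionality demanded by \<open>simplicial_map\<close>.\<close>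

definition poset_square :: "(nat \<times> nat \<Rightarrow> 'a) \<Rightarrow> nat \<Rightarrow> nat list \<times> nat list \<Rightarrow> 'a list" where
  "poset_square \<phi> k =
     restrict (\<lambda>(xs, ys). map \<phi> (zip xs ys)) (simplices (sset_prod (std_simplex 1) (std_simplex 1)) k)"

lemma sq_edge_poset_square:
  assumes "i \<le> i'" "i' \<le> 1" "j \<le> j'" "j' \<le> 1"
  shows "sq_edge (poset_square \<phi>) (i, j) (i', j') = [\<phi> (i, j), \<phi> (i', j')]"
  using assms by (simp add: poset_square_def sq_edge_def sset_prod_def std_simplex_def nerve_def One_nat_def)

text \<open>Monotonicity sends chains of the square to chains in the cell \<open>c\<close>. Faces
  and degeneracies delete or repeat the same entry in both lists, which commutes with
  \<open>zip\<close> and \<open>map\<close>.\<close>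

lemma simplicial_map_poset_square:
  assumes mono: "\<And>i j i' j'. i \<le> i' \<Longrightarrow> i' \<le> 1 \<Longrightarrow> j \<le> j' \<Longrightarrow> j' \<le> 1 \<Longrightarrow> \<phi> (i, j) \<subseteq> \<phi> (i', j')"
    and cell: "c \<in> K" "\<And>i j. i \<le> 1 \<Longrightarrow> j \<le> 1 \<Longrightarrow> \<phi> (i, j) \<in> c"
  shows "simplicial_map (sset_prod (std_simplex 1) (std_simplex 1)) (triangulation K) (poset_square \<phi>)"
proof -
  let ?S = "sset_prod (std_simplex 1) (std_simplex 1)"
  have simplex: "(xs, ys) \<in> simplices ?S k \<longleftrightarrow> length xs = Suc k \<and> length ys = Suc k \<and>
      sorted xs \<and> sorted ys \<and> set xs \<subseteq> {..1} \<and> set ys \<subseteq> {..1}" for xs ys k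
    by (auto simp: sset_prod_def std_simplex_def nerve_def)
  have face_S: "face ?S k i (xs, ys) = (take i xs @ drop (Suc i) xs, take i ys @ drop (Suc i) ys)"
    and degen_S: "degen ?S k i (xs, ys) = (take (Suc i) xs @ drop i xs, take (Suc i) ys @ drop i ys)"
    for k i xs ys
    by (simp_all add: sset_prod_def std_simplex_def nerve_def)
  \<comment> \<open>Exposing the entry at index \<open>i\<close> turns the \<open>take\<close> and
    \<open>drop\<close> of the operators into plain appends.\<close>
  have split_at: "\<exists>as x bs. xs = as @ x # bs \<and> length as = i" if "length xs = Suc k" "i \<le> k"
    for xs :: "nat list" and k i
    using that id_take_nth_drop[of i xs] by (metis le_imp_less_Suc length_take min.absorb2 nless_le)
  have nerve: "map \<phi> (zip xs ys) \<in> simplices (triangulation K) k" if "(xs, ys) \<in> simplices ?S k" for k xs ys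
  proof -
    have xs: "length xs = Suc k" "length ys = Suc k" "sorted xs" "sorted ys"
      and le: "m < Suc k \<Longrightarrow> xs ! m \<le> 1" "m < Suc k \<Longrightarrow> ys ! m \<le> 1" for m
      using that unfolding simplex by (auto simp: subset_iff dest: nth_mem)
    have "\<phi> (xs ! a, ys ! a) \<subseteq> \<phi> (xs ! b, ys ! b)" if "a < b" "b < Suc k" for a b
      using mono[OF sorted_nth_mono[OF xs(3)] le(1) sorted_nth_mono[OF xs(4)] le(2)] xs(1,2) that by simp
    then have "sorted_wrt (\<subseteq>) (map \<phi> (zip xs ys))"
      using xs(1,2) by (simp add: sorted_wrt_iff_nth_less)
    moreover have "set (map \<phi> (zip xs ys)) \<subseteq> c"
      using xs le cell(2) by (auto simp: in_set_conv_nth)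
    ultimately show ?thesis
      using xs cell(1) by (auto simp: triangulation_def nerve_def)
  qed
  have face: "face ?S (Suc k) i (xs, ys) \<in> simplices ?S k \<and>
      (\<lambda>(xs, ys). map \<phi> (zip xs ys)) (face ?S (Suc k) i (xs, ys))
        = face (triangulation K) (Suc k) i (map \<phi> (zip xs ys))"
    if S: "(xs, ys) \<in> simplices ?S (Suc k)" and i: "i \<le> Suc k" for k i xs ys
  proof -
    obtain as x bs cs y ds where *: "xs = as @ x # bs" "length as = i" "ys = cs @ y # ds" "length cs = i"
      using split_at[of xs "Suc k" i] split_at[of ys "Suc k" i] S i unfolding simplex by blast
    with S show ?thesis
      unfolding face_S simplex
      by (auto simp: simplex sorted_append face_triangulation nerve_def)
  qed
  have degen: "degen ?S k i (xs, ys) \<in> simplices ?S (Suc k) \<and>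
      (\<lambda>(xs, ys). map \<phi> (zip xs ys)) (degen ?S k i (xs, ys))
        = degen (triangulation K) k i (map \<phi> (zip xs ys))"
    if S: "(xs, ys) \<in> simplices ?S k" and i: "i \<le> k" for k i xs ys
  proof -
    obtain as x bs cs y ds where *: "xs = as @ x # bs" "length as = i" "ys = cs @ y # ds" "length cs = i"
      using split_at[of xs k i] split_at[of ys k i] S i unfolding simplex by blast
    with S show ?thesis
      unfolding degen_S simplex
      by (auto simp: simplex sorted_append degen_triangulation nerve_def)
  qed
  show ?thesis
    unfolding simplicial_map_def
  proof (intro conjI allI ballI impI)
    fix k
    show "poset_square \<phi> k \<in> simplices ?S k \<rightarrow>\<^sub>E simplices (triangulation K) k"
      unfolding poset_square_def using nerve by auto
  next
    fix k i x
    assume "x \<in> simplices ?S (Suc k)" "i \<le> Suc k"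
    then show "poset_square \<phi> k (face ?S (Suc k) i x)
        = face (triangulation K) (Suc k) i (poset_square \<phi> (Suc k) x)"
      using face[of "fst x" "snd x" k i] by (simp add: poset_square_def split_beta)
  next
    fix k i x
    assume "x \<in> simplices ?S k" "i \<le> k"
    then show "poset_square \<phi> (Suc k) (degen ?S k i x)
        = degen (triangulation K) k i (poset_square \<phi> k x)"
      using degen[of "fst x" "snd x" k i] by (simp add: poset_square_def split_beta)
  qed
qed

text \<open>The vertices (0,0), (0,1), (1,0), (1,1) go to \<open>F\<close>, \<open>G\<close>,
  \<open>H\<close>, \<open>I\<close>, all inside the single cell \<open>{F..I}\<close>;
  \<open>G\<close> and \<open>H\<close> may be incomparable.\<close>

lemma square_exists:
  assumes "{F..I} \<in> K" "F \<subseteq> G" "G \<subseteq> I" "F \<subseteq> H" "H \<subseteq> I"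
    and "[F, G] \<in> simplices XA 1" "[H, I] \<in> simplices XB 1"
  shows "\<exists>\<omega>\<in>squares (triangulation K) XA XB. sq_edge \<omega> (0, 0) (0, 1) = [F, G] \<and>
    sq_edge \<omega> (0, 1) (1, 1) = [G, I] \<and> sq_edge \<omega> (0, 0) (1, 0) = [F, H] \<and>
    sq_edge \<omega> (1, 0) (1, 1) = [H, I]"
proof -
  define \<phi> where
    "\<phi> = (\<lambda>(i :: nat, j :: nat). if i = 0 then if j = 0 then F else G else if j = 0 then H else I)"
  have "simplicial_map (sset_prod (std_simplex 1) (std_simplex 1)) (triangulation K) (poset_square \<phi>)"
    using assms by (intro simplicial_map_poset_square[where c = "{F..I}"]) (auto simp: \<phi>_def)
  moreover have "sq_edge (poset_square \<phi>) (0, 0) (0, 1) = [F, G]"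
    "sq_edge (poset_square \<phi>) (0, 1) (1, 1) = [G, I]" "sq_edge (poset_square \<phi>) (0, 0) (1, 0) = [F, H]"
    "sq_edge (poset_square \<phi>) (1, 0) (1, 1) = [H, I]"
    by (simp_all add: sq_edge_poset_square \<phi>_def)
  ultimately show ?thesis
    using assms by (intro bexI[of _ "poset_square \<phi>"]) (auto simp: squares_def)
qed

text \<open>By \<open>interval_in_level_iff\<close> a cell of \<open>K\<close> lies in
  \<open>A\<close> as soon as its top vertex does, and in \<open>B\<close> as soon as its bottom
  vertex does.\<close>

lemma cut_sset_level:
  assumes K: "cubical_complex n K"
  shows "cut_sset (triangulation K) (triangulation (level K 0 M)) (triangulation (level K (M + 1) n))"
proof -
  let ?X = "triangulation K" and ?A = "triangulation (level K 0 M)"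
    and ?B = "triangulation (level K (M + 1) n)"
  note level = cubical_complex_level[OF K]
  have "level K r s \<subseteq> K" for r s
    by (auto simp: level_def)
  then interpret truncated_sset ?X + A: truncated_subset ?A ?X + B: truncated_subset ?B ?X
    by (simp_all add: truncated_sset_triangulation[OF K] truncated_subset_triangulation[OF level K])
  note [simp] = vertices_triangulation[OF K] edges_triangulation[OF K] triangles_triangulation[OF K]
    vertices_triangulation[OF level] edges_triangulation[OF level] triangles_triangulation[OF level]
    src_triangulation tgt_triangulation faces_triangle degen_vertex interval_in_level_iff[OF K]
  \<comment> \<open>Supplies the upper bound \<open>n\<close> in the definition of
    \<open>B\<close>.\<close>
  note bound = cubical_complex_card[OF K] and sub = cubical_complex_subinterval[OF K]
  have mono: "card F \<le> card G" if "{F..G} \<in> K" "F \<subseteq> G" for F G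
    using that by (intro card_mono cubical_complex_finite[OF K])
  show ?thesis
  proof
    fix z e \<tau>
    show "z \<in> simplices ?X 0 \<Longrightarrow> z \<in> simplices ?A 0 \<or> z \<in> simplices ?B 0"
      using bound by auto
    show "z \<in> simplices ?A 0 \<Longrightarrow> z \<notin> simplices ?B 0"
      by auto
    show "e \<in> simplices ?X 1 \<Longrightarrow> tgt ?X e \<in> simplices ?A 0 \<Longrightarrow> e \<in> simplices ?A 1"
      by auto
    show "e \<in> simplices ?X 1 \<Longrightarrow> src ?X e \<in> simplices ?B 0 \<Longrightarrow> e \<in> simplices ?B 1"
      using bound by auto
    show "\<tau> \<in> simplices ?X 2 \<Longrightarrow> tgt ?X (face ?X 2 1 \<tau>) \<in> simplices ?A 0 \<Longrightarrow> \<tau> \<in> simplices ?A 2"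
      by auto
    show "\<tau> \<in> simplices ?X 2 \<Longrightarrow> src ?X (face ?X 2 1 \<tau>) \<in> simplices ?B 0 \<Longrightarrow> \<tau> \<in> simplices ?B 2"
      using bound by auto
  next
    fix \<tau>
    assume "\<tau> \<in> simplices ?X 2" "face ?X 2 2 \<tau> \<in> simplices ?A 1" "tgt ?X (face ?X 2 1 \<tau>) \<in> simplices ?B 0"
    then obtain F G H where "\<tau> = [F, G, H]" "F \<subseteq> G" "G \<subseteq> H" "{F..H} \<in> K"
      "[F, G] \<in> simplices ?A 1" "[H, H] \<in> simplices ?B 1"
      by auto
    \<comment> \<open>The square has vertices \<open>F\<close>, \<open>G\<close>, \<open>H\<close>,
      \<open>H\<close>. The edge characterization is kept out of the simplifier so that the two
      membership facts match the premises of \<open>square_exists\<close>.\<close>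
    then show "\<exists>\<omega>\<in>squares ?X ?A ?B. sq_edge \<omega> (0, 0) (0, 1) = face ?X 2 2 \<tau> \<and>
        sq_edge \<omega> (0, 1) (1, 1) = face ?X 2 0 \<tau> \<and> sq_edge \<omega> (0, 0) (1, 0) = face ?X 2 1 \<tau> \<and>
        sq_edge \<omega> (1, 0) (1, 1) = degen ?X 0 0 (tgt ?X (face ?X 2 1 \<tau>))"
      using square_exists[of F H K G H ?A ?B] by (simp del: edges_triangulation[OF level])
  next
    fix \<tau>
    assume "\<tau> \<in> simplices ?X 2" "src ?X (face ?X 2 1 \<tau>) \<in> simplices ?A 0" "face ?X 2 0 \<tau> \<in> simplices ?B 1"
    then obtain F G H where "\<tau> = [F, G, H]" "F \<subseteq> G" "G \<subseteq> H" "{F..H} \<in> K"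
      "[F, F] \<in> simplices ?A 1" "[G, H] \<in> simplices ?B 1"
      by auto
    \<comment> \<open>Here the vertices are \<open>F\<close>, \<open>F\<close>, \<open>G\<close>,
      \<open>H\<close>, with the degenerate side at \<open>F\<close>.\<close>
    then show "\<exists>\<omega>\<in>squares ?X ?A ?B. sq_edge \<omega> (0, 0) (0, 1) = degen ?X 0 0 (src ?X (face ?X 2 1 \<tau>)) \<and>
        sq_edge \<omega> (0, 1) (1, 1) = face ?X 2 1 \<tau> \<and> sq_edge \<omega> (0, 0) (1, 0) = face ?X 2 2 \<tau> \<and>
        sq_edge \<omega> (1, 0) (1, 1) = face ?X 2 0 \<tau>"
      using square_exists[of F H K F G ?A ?B] by (simp del: edges_triangulation[OF level])
  qed
qed

text \<open>\<open>K\<close> is itself one of the complexes in the intersection.\<close>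

lemma generated_subcomplex_subset:
  "cubical_complex n K \<Longrightarrow> G \<subseteq> K \<Longrightarrow> generated_subcomplex n K G \<subseteq> K"
  by (auto simp: generated_subcomplex_def)

lemma generators_subset: "G \<subseteq> generated_subcomplex n K G"
  by (auto simp: generated_subcomplex_def)

text \<open>The dimension bound enters here: the interval spanned by a crossing edge has dimension 1
  or 2 and vertices on both sides, so it is one of the generators of \<open>L\<close>.\<close>

lemma crossing_edges_frontier:
  fixes n M :: nat and K A B L :: "nat set set set"
  assumes K: "cubical_complex n K" and dim: "skeleton 2 K = K"
  defines "A \<equiv> level K 0 M" and "B \<equiv> level K (M + 1) n" and "L \<equiv> frontier_subcomplex n K M"
  shows "crossing_edges (triangulation L) (triangulation A) (triangulation B) =
    {\<sigma> \<in> simplices (triangulation K) 1.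
      src (triangulation K) \<sigma> \<in> simplices (triangulation A) 0 \<and>
      tgt (triangulation K) \<sigma> \<in> simplices (triangulation B) 0}"
    (is "_ = ?R")
proof (rule antisym)
  have "L \<subseteq> K"
    unfolding L_def frontier_subcomplex_def by (rule generated_subcomplex_subset[OF K]) auto
  from simplices_triangulation_mono[OF this, of 1]
  show "crossing_edges (triangulation L) (triangulation A) (triangulation B) \<subseteq> ?R"
    by (auto simp: crossing_edges_def src_def tgt_def face_triangulation)
  note level = cubical_complex_level[OF K]
  show "?R \<subseteq> crossing_edges (triangulation L) (triangulation A) (triangulation B)"
  proof
    fix \<sigma>
    assume "\<sigma> \<in> ?R"
    then obtain F G where \<sigma>: "\<sigma> = [F, G]" "F \<subseteq> G" "{F..G} \<in> K" "{F..F} \<in> A" "{G..G} \<in> B"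
      and R: "\<sigma> \<in> ?R"
      by (auto simp: edges_triangulation[OF K] vertices_triangulation[OF level] src_triangulation
          tgt_triangulation A_def B_def)
    then have card: "card F \<le> M" "M + 1 \<le> card G"
      by (auto simp: A_def B_def interval_in_level_iff[OF K])
    \<comment> \<open>The skeleton presents the cell by some pair of ends of codimension at most 2;
      a nonempty interval determines its ends, so this pair is \<open>F\<close>,
      \<open>G\<close>.\<close>
    from \<sigma>(2,3) dim have "card (G - F) \<le> 2"
      unfolding skeleton_def by (smt (verit, del_insts) interval_eq_iff mem_Collect_eq)
    \<comment> \<open>Equal ends would contradict \<open>card F \<le> M < card G\<close>.\<close>
    moreover have "G - F \<noteq> {}" "finite G"
      using card \<sigma> cubical_complex_finite[OF K] by auto
    then have "card (G - F) > 0"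
      by (simp add: card_gt_0_iff)
    ultimately have "card (G - F) \<in> {1, 2}"
      by auto
    moreover have "F \<in> {F..G} \<inter> vertices A" "G \<in> {F..G} \<inter> vertices B"
      using \<sigma> by (auto simp: vertices_def)
    ultimately have "{F..G} \<in> L"
      using \<sigma>(2,3) unfolding L_def frontier_subcomplex_def A_def B_def
      by (intro subsetD[OF generators_subset]) blast
    with \<sigma> have "\<sigma> \<in> simplices (triangulation L) 1"
      by (auto simp: triangulation_def nerve_def One_nat_def intro!: bexI[of _ "{F..G}"])
    with R show "\<sigma> \<in> crossing_edges (triangulation L) (triangulation A) (triangulation B)"
      by (simp add: crossing_edges_def src_def tgt_def face_triangulation)
  qed
qed

theorem lemma16:
  fixes n M :: nat and K A B L :: "nat set set set" and u v :: "nat set"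
    and XK XA XB XL :: "nat set list sset"
  assumes "cubical_complex n K" and "skeleton 2 K = K" and "0 < M" and "M < n"
    and "A = level K 0 M" and "B = level K (M + 1) n" and "L = frontier_subcomplex n K M"
    and "XK = triangulation K" and "XA = triangulation A"
    and "XB = triangulation B" and "XL = triangulation L"
    and "u \<in> vertices A" and "v \<in> vertices B"
  shows "is_coequalizer TYPE('z)
    (SIGMA \<omega> : squares XK XA XB.
       path_hom XA [u] (sq_vertex \<omega> (0, 0)) \<times> path_hom XB (sq_vertex \<omega> (1, 1)) [v])
    (SIGMA \<sigma> : crossing_edges XL XA XB.
       path_hom XA [u] (src XL \<sigma>) \<times> path_hom XB (tgt XL \<sigma>) [v])
    (path_hom XK [u] [v])
    (\<lambda>(\<omega>, p, q). (sq_edge \<omega> (0, 0) (1, 0),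
       p, path_comp XB q (path_edge XB (sq_edge \<omega> (1, 0) (1, 1)))))
    (\<lambda>(\<omega>, p, q). (sq_edge \<omega> (0, 1) (1, 1),
       path_comp XA (path_edge XA (sq_edge \<omega> (0, 0) (0, 1))) p, q))
    (\<lambda>(\<sigma>, p, q). path_comp XK (path_incl XK q) (path_comp XK (path_edge XK \<sigma>) (path_incl XK p)))"
proof -
  interpret cut_sset XK XA XB
    using cut_sset_level assms by simp
  \<comment> \<open>Identifies the index set of the middle coproduct with the crossing edges of the
    whole complex.\<close>
  have "crossing_edges XL XA XB = crossing"
    using crossing_edges_frontier[OF assms(1,2), of M] unfolding crossing_def unfolding assms(5-11) .
  moreover have "src XL = src XK" "tgt XL = tgt XK"
    using assms by (simp_all add: src_def tgt_def face_triangulation fun_eq_iff)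
  moreover have "[u] \<in> simplices XA 0" "[v] \<in> simplices XB 0"
    using assms by (auto simp: vertices_triangulation cubical_complex_level vertices_def
        intro!: iffD2[OF vertices_triangulation[OF cubical_complex_level]])
  ultimately show ?thesis
    using coequalizer by simp
qed

end
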